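(* Let $m\ge 4$ and let $C=C_1\cup\dots\cup C_m\subset\mathbb{P}^2$ be a normal crossing divisor whose irreducible components $C_j:f_j=0$ are smooth curves of degree $e_j$; let $f=f_1\cdots f_m$ and $d=\deg f=e_1+\dots+e_m$. Assume that at least three components of $C$ are lines and that $f_1=x$, $f_2=y$, $f_3=z$. Then the minimal graded free resolution of the graded $S$-module $D_0(f)$ has the shape $$0\to\bigoplus_{j=4}^{m}S(-d+2-e_j)\to S(-d+2)^{m-1}\ (\to D_0(f)\to 0),$$ and hence the minimal graded free resolution of the Jacobian algebra $M(f)$ has the shape $$0\to\bigoplus_{j=4}^{m}S(-2d+3-e_j)\to S(-2d+3)^{m-1}\to S(-d+1)^3\to S\ (\to M(f)\to 0).$$ Moreover, the $m-3$ generating syzygies $\rho_4,\dots,\rho_m$ of $D_0(f)$ (i.e. the generators of the module of relations among the generators of $D_0(f)$, given by the first map of the first resolution) correspond to the following relations among the 2-forms $\omega_1,\dots,\omega_{m-1}$ that generate $D_0(f)$: $$\rho_j:\quad f_j\omega_j-(x f_{j,x}\,\omega_1+y f_{j,y}\,\omega_2+z f_{j,z}\,\omega_3)=0,\qquad j=4,\dots,m,$$ where for $j=m$ the form $\omega_m$ has to be replaced by $-\sum_{i=1}^{m-1}\omega_i$.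
   Context: $S=\mathbb{C}[x,y,z]$ with its standard grading, and $\mathbb{P}^2$ is the complex projective plane. For $f\in S$ homogeneous with partial derivatives $f_x,f_y,f_z$, the Jacobian ideal is $J_f=(f_x,f_y,f_z)$, the Jacobian (Milnor) algebra is $M(f)=S/J_f$, and the graded module of Jacobian syzygies is $D_0(f)=\{(a,b,c)\in S^3: af_x+bf_y+cf_z=0\}$; a homogeneous syzygy $(a,b,c)$ has degree equal to the common degree of $a,b,c$. $f_{j,x},f_{j,y},f_{j,z}$ denote the partial derivatives of $f_j$. $\Omega^j$ is the $S$-module of polynomial differential $j$-forms on $\mathbb{C}^3$. A triple $(a,b,c)\in S^3$ is identified with the 2-form $a\,dy\wedge dz-b\,dx\wedge dz+c\,dx\wedge dy$; under this identification $D_0(f)$ corresponds to the 2-forms $\omega$ with $df\wedge\omega=0$. Define for $j=1,\dots,m$ $$\omega_j=df\wedge\frac{df_j}{f_j}=\sum_{1\le i\le m,\ i\ne j}\frac{f}{f_if_j}\,df_i\wedge df_j\in\Omega^2 .$$ These satisfy $\sum_{j=1}^m\omega_j=0$. *)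

theory Defs
  imports
    "HOL-Algebra.Algebraic_Closure_Type"
    "HOL-Algebra.QuotRing"
    "HOL-Algebra.Module"
    "HOL-Library.Product_Plus"
    "HOL-Computational_Algebra.Computational_Algebra"
    Complex_Main
begin

section \<open>The graded ring of polynomials in three variables\<close>

text \<open>\<open>S = \<complex>[x,y,z]\<close> is represented as \<open>\<complex>[x][y][z]\<close>: the innermost variable is \<open>x\<close>,
  the outermost one is \<open>z\<close>.\<close>

type_synonym mpoly = "complex poly poly poly"

abbreviation S :: "mpoly ring" where
  "S \<equiv> ring_of_type_algebra"

definition var_x :: mpoly where "var_x = [:[:[:0, 1:]:]:]"
definition var_y :: mpoly where "var_y = [:[:0, 1:]:]"
definition var_z :: mpoly where "var_z = [:0, 1:]"

definition mcoeff :: "mpoly \<Rightarrow> nat \<Rightarrow> nat \<Rightarrow> nat \<Rightarrow> complex" where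
  "mcoeff p i j k = Polynomial.coeff (Polynomial.coeff (Polynomial.coeff p k) j) i"

text \<open>Degrees are integers, so that twists are unproblematic; the zero polynomial is
  homogeneous of every degree and it is the only one homogeneous of a negative degree.\<close>

definition homogeneous :: "int \<Rightarrow> mpoly \<Rightarrow> bool" where
  "homogeneous n p \<longleftrightarrow> (\<forall>i j k. mcoeff p i j k \<noteq> 0 \<longrightarrow> int (i + j + k) = n)"

definition d_x :: "mpoly \<Rightarrow> mpoly" where "d_x = map_poly (map_poly pderiv)"
definition d_y :: "mpoly \<Rightarrow> mpoly" where "d_y = map_poly pderiv"
definition d_z :: "mpoly \<Rightarrow> mpoly" where "d_z = pderiv"

fun meval :: "mpoly \<Rightarrow> complex \<times> complex \<times> complex \<Rightarrow> complex" where
  "meval p (a, b, c) = poly (poly (poly p [:[:c:]:]) [:b:]) a"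

definition max_ideal :: "mpoly set" where
  "max_ideal = genideal S {var_x, var_y, var_z}"

section \<open>Plane curves\<close>

text \<open>Points of \<open>\<P>\<^sup>2\<close> are given by their nonzero representatives in \<open>\<complex>\<^sup>3\<close>.\<close>

definition smooth_curve :: "mpoly \<Rightarrow> bool" where
  "smooth_curve p \<longleftrightarrow>
     (\<forall>P. P \<noteq> (0, 0, 0) \<and> meval p P = 0 \<longrightarrow>
        (meval (d_x p) P, meval (d_y p) P, meval (d_z p) P) \<noteq> (0, 0, 0))"

text \<open>A divisor with smooth components has normal crossings if at every point \<open>P\<close> the local
  equations of the components through \<open>P\<close> are part of a system of local coordinates, that is, if
  their differentials are linearly independent in the cotangent space at \<open>P\<close>.
  The cotangent space of \<open>\<P>\<^sup>2\<close> at \<open>P\<close> is the space of linear forms on \<open>\<complex>\<^sup>3\<close> vanishing at \<open>P\<close>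
  (up to the choice of a representative), and by Euler's formula it contains the differential at
  \<open>P\<close> of every homogeneous polynomial vanishing at \<open>P\<close>. As that space has dimension two, no
  three components have a common point, and two components meet transversally.\<close>

definition normal_crossing :: "nat set \<Rightarrow> (nat \<Rightarrow> mpoly) \<Rightarrow> bool" where
  "normal_crossing I f \<longleftrightarrow>
     (\<forall>P. P \<noteq> (0, 0, 0) \<longrightarrow>
       (let J = {j \<in> I. meval (f j) P = 0} in
         \<forall>c :: nat \<Rightarrow> complex.
           (\<Sum>j\<in>J. c j * meval (d_x (f j)) P) = 0 \<and>
           (\<Sum>j\<in>J. c j * meval (d_y (f j)) P) = 0 \<and>
           (\<Sum>j\<in>J. c j * meval (d_z (f j)) P) = 0 \<longrightarrow> (\<forall>j\<in>J. c j = 0)))"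

section \<open>Graded modules\<close>

text \<open>\<open>component M n\<close> is the set of homogeneous elements of degree \<open>n\<close> of \<open>M\<close>. The fields \<open>mult\<close>
  and \<open>one\<close>, inherited from the record type of rings, play no role for modules.\<close>

record 'b graded_module = "(mpoly, 'b) module" +
  component :: "int \<Rightarrow> 'b set"

type_synonym triple = "mpoly \<times> mpoly \<times> mpoly"

fun tsmult :: "mpoly \<Rightarrow> triple \<Rightarrow> triple" (infixr \<open>\<bullet>\<close> 75) where
  "p \<bullet> (a, b, c) = (p * a, p * b, p * c)"

definition D0_carrier :: "mpoly \<Rightarrow> triple set" where
  "D0_carrier f = {(a, b, c). a * d_x f + b * d_y f + c * d_z f = 0}"

definition D0 :: "mpoly \<Rightarrow> triple graded_module" where
  "D0 f = \<lparr>carrier = D0_carrier f, monoid.mult = undefined, one = undefined, zero = 0, add = (+),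
     module.smult = (\<bullet>),
     component = (\<lambda>n. {(a, b, c) \<in> D0_carrier f.
       homogeneous n a \<and> homogeneous n b \<and> homogeneous n c})\<rparr>"

definition jacobian_ideal :: "mpoly \<Rightarrow> mpoly set" where
  "jacobian_ideal f = genideal S {d_x f, d_y f, d_z f}"

definition milnor_algebra :: "mpoly \<Rightarrow> mpoly set graded_module" where
  "milnor_algebra f = (let J = jacobian_ideal f; Q = FactRing S J in
     \<lparr>carrier = carrier Q, monoid.mult = monoid.mult Q, one = \<one>\<^bsub>Q\<^esub>, zero = \<zero>\<^bsub>Q\<^esub>, add = add Q,
      module.smult = (\<lambda>p. monoid.mult Q (J +>\<^bsub>S\<^esub> p)),
      component = (\<lambda>n. {J +>\<^bsub>S\<^esub> p | p. homogeneous n p})\<rparr>)"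

text \<open>A pair \<open>(I, t)\<close> describes the graded free module \<open>\<Oplus>i\<in>I. S(t i)\<close>, where
  \<open>S(k)\<^sub>n = S\<^sub>k\<^sub>+\<^sub>n\<close>; its elements are the functions vanishing outside \<open>I\<close>.\<close>

type_synonym twists = "nat set \<times> (nat \<Rightarrow> int)"

definition free_carrier :: "nat set \<Rightarrow> (nat \<Rightarrow> mpoly) set" where
  "free_carrier I = {v. \<forall>i. i \<notin> I \<longrightarrow> v i = 0}"

fun graded_free :: "twists \<Rightarrow> (nat \<Rightarrow> mpoly) graded_module" where
  "graded_free (I, t) =
    \<lparr>carrier = free_carrier I, monoid.mult = undefined, one = undefined,
     zero = (\<lambda>_. 0), add = (\<lambda>v w i. v i + w i), module.smult = (\<lambda>p v i. p * v i),
     component = (\<lambda>n. {v \<in> free_carrier I. \<forall>i\<in>I. homogeneous (t i + n) (v i)})\<rparr>"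

text \<open>Homomorphisms of graded modules, of degree zero.\<close>

definition graded_hom :: "'b graded_module \<Rightarrow> 'c graded_module \<Rightarrow> ('b \<Rightarrow> 'c) \<Rightarrow> bool" where
  "graded_hom M N \<phi> \<longleftrightarrow>
     \<phi> \<in> carrier M \<rightarrow> carrier N \<and>
     (\<forall>u\<in>carrier M. \<forall>v\<in>carrier M. \<phi> (u \<oplus>\<^bsub>M\<^esub> v) = \<phi> u \<oplus>\<^bsub>N\<^esub> \<phi> v) \<and>
     (\<forall>p. \<forall>v\<in>carrier M. \<phi> (p \<odot>\<^bsub>M\<^esub> v) = p \<odot>\<^bsub>N\<^esub> \<phi> v) \<and>
     (\<forall>n. \<phi> ` component M n \<subseteq> component N n)"

section \<open>Minimal graded free resolutions\<close>

text \<open>For \<open>Ts = [T\<^sub>0, \<dots>, T\<^sub>n]\<close> and \<open>\<phi>s = [\<phi>\<^sub>0, \<dots>, \<phi>\<^sub>n\<^sub>-\<^sub>1]\<close>, the following says that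
  \<open>0 \<rightarrow> F\<^sub>n \<rightarrow> \<dots> \<rightarrow> F\<^sub>1 \<rightarrow> F\<^sub>0 \<rightarrow> M \<rightarrow> 0\<close>, with \<open>F\<^sub>i\<close> the free module described by \<open>T\<^sub>i\<close>, with
  \<open>\<phi>\<^sub>i : F\<^sub>i\<^sub>+\<^sub>1 \<rightarrow> F\<^sub>i\<close> and with augmentation \<open>\<epsilon> : F\<^sub>0 \<rightarrow> M\<close>, is an exact complex of graded modules
  such that \<open>\<phi>\<^sub>i(F\<^sub>i\<^sub>+\<^sub>1) \<subseteq> (x,y,z) F\<^sub>i\<close> for all \<open>i\<close>.\<close>

definition minimal_graded_free_resolution ::
  "'b graded_module \<Rightarrow> twists list \<Rightarrow> ((nat \<Rightarrow> mpoly) \<Rightarrow> 'b) \<Rightarrow>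
   ((nat \<Rightarrow> mpoly) \<Rightarrow> (nat \<Rightarrow> mpoly)) list \<Rightarrow> bool" where
  "minimal_graded_free_resolution M Ts \<epsilon> \<phi>s \<longleftrightarrow>
    (let F = (\<lambda>i. graded_free (Ts ! i));
         ker = (\<lambda>i. {v \<in> carrier (F i).
                  if i = 0 then \<epsilon> v = \<zero>\<^bsub>M\<^esub> else (\<phi>s ! (i - 1)) v = \<zero>\<^bsub>F (i - 1)\<^esub>});
         im = (\<lambda>i. if i < length \<phi>s then (\<phi>s ! i) ` carrier (F (Suc i)) else {\<zero>\<^bsub>F i\<^esub>})
     in length Ts = Suc (length \<phi>s) \<and>
        (\<forall>(I, t)\<in>set Ts. finite I) \<and>
        graded_hom (F 0) M \<epsilon> \<and>
        (\<forall>i<length \<phi>s. graded_hom (F (Suc i)) (F i) (\<phi>s ! i)) \<and>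
        \<epsilon> ` carrier (F 0) = carrier M \<and>
        (\<forall>i<length Ts. ker i = im i) \<and>
        (\<forall>i<length \<phi>s. \<forall>v\<in>carrier (F (Suc i)). \<forall>k. (\<phi>s ! i) v k \<in> max_ideal))"

text \<open>As minimal graded free resolutions are unique up to isomorphism, the following is what is
  meant by saying that the minimal graded free resolution of \<open>M\<close> has a certain shape.\<close>

definition has_minimal_resolution_of_shape :: "'b graded_module \<Rightarrow> twists list \<Rightarrow> bool" where
  "has_minimal_resolution_of_shape M Ts \<longleftrightarrow>
    (\<exists>\<epsilon> \<phi>s. minimal_graded_free_resolution M Ts \<epsilon> \<phi>s)"

section \<open>The forms \<open>\<omega>\<^sub>j\<close> and the relations \<open>\<rho>\<^sub>j\<close>\<close>

text \<open>A triple \<open>(p, q, r)\<close> stands for the 1-form \<open>p dx + q dy + r dz\<close>, or, when it is viewed as a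
  2-form, \<open>(a, b, c)\<close> stands for \<open>a dy\<and>dz - b dx\<and>dz + c dx\<and>dy\<close>. With these conventions
  \<open>df \<and> (a, b, c) = (a f\<^sub>x + b f\<^sub>y + c f\<^sub>z) dx\<and>dy\<and>dz\<close>.\<close>

definition ext_d :: "mpoly \<Rightarrow> triple" where
  "ext_d p = (d_x p, d_y p, d_z p)"

fun wedge :: "triple \<Rightarrow> triple \<Rightarrow> triple" where
  "wedge (p, q, r) (p', q', r') = (q * r' - r * q', - (p * r' - r * p'), p * q' - q * p')"

text \<open>The product over \<open>k\<close> below is \<open>f / (f\<^sub>i f\<^sub>j)\<close> for \<open>f = f\<^sub>1 \<cdots> f\<^sub>m\<close>.\<close>

definition omega :: "nat \<Rightarrow> (nat \<Rightarrow> mpoly) \<Rightarrow> nat \<Rightarrow> triple" where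
  "omega m f j = (\<Sum>i\<in>{1..m} - {j}. (\<Prod>k\<in>{1..m} - {i, j}. f k) \<bullet> wedge (ext_d (f i)) (ext_d (f j)))"

definition unit_vec :: "nat \<Rightarrow> nat \<Rightarrow> mpoly" where
  "unit_vec i k = (if k = i then 1 else 0)"

text \<open>\<open>\<rho>\<^sub>j\<close> as a vector of coefficients with respect to the generators \<open>\<omega>\<^sub>1, \<dots>, \<omega>\<^sub>m\<^sub>-\<^sub>1\<close>; for \<open>j = m\<close>
  the missing generator \<open>\<omega>\<^sub>m\<close> is replaced by \<open>-(\<omega>\<^sub>1 + \<dots> + \<omega>\<^sub>m\<^sub>-\<^sub>1)\<close>.\<close>

definition rho :: "nat \<Rightarrow> (nat \<Rightarrow> mpoly) \<Rightarrow> nat \<Rightarrow> (nat \<Rightarrow> mpoly)" where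
  "rho m f j = (\<lambda>k.
     f j * (if j = m then - (\<Sum>i\<in>{1..m-1}. unit_vec i k) else unit_vec j k)
     - (var_x * d_x (f j) * unit_vec 1 k + var_y * d_y (f j) * unit_vec 2 k
        + var_z * d_z (f j) * unit_vec 3 k))"

definition omega_map :: "nat \<Rightarrow> (nat \<Rightarrow> mpoly) \<Rightarrow> (nat \<Rightarrow> mpoly) \<Rightarrow> triple" where
  "omega_map m f v = (\<Sum>i\<in>{1..m-1}. v i \<bullet> omega m f i)"

definition rho_map :: "nat \<Rightarrow> (nat \<Rightarrow> mpoly) \<Rightarrow> (nat \<Rightarrow> mpoly) \<Rightarrow> (nat \<Rightarrow> mpoly)" where
  "rho_map m f w = (\<lambda>k. \<Sum>j\<in>{4..m}. w j * rho m f j k)"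

end

theory Submission
  imports Defs "HOL-Analysis.Continuum_Not_Denumerable"
begin

text \<open>
  Let \<open>F = f\<^sub>1 \<cdots> f\<^sub>m\<close>. When 2-forms and vectors are identified, \<open>f\<^sub>j \<omega>\<^sub>j\<close> is the vector product of the
  gradients of \<open>F\<close> and \<open>f\<^sub>j\<close>. This gives the relations \<open>\<rho>\<^sub>j\<close>, because the gradient of \<open>f\<^sub>j\<close> is a
  combination of the gradients of \<open>x\<close>, \<open>y\<close>, \<open>z\<close>, and it shows that the \<open>\<omega>\<^sub>j\<close> are syzygies. What has to be
  proved is that \<open>0 \<rightarrow> S\<^sup>m\<^sup>-\<^sup>3 \<rightarrow> S\<^sup>m\<^sup>-\<^sup>1 \<rightarrow> D\<^sub>0(F) \<rightarrow> 0\<close> is exact, with the maps given by the \<open>\<rho>\<^sub>j\<close> and by the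
  \<open>\<omega>\<^sub>j\<close>.

  A syzygy \<open>\<theta>\<close> satisfies \<open>\<theta>(f\<^sub>i) = f\<^sub>i g\<^sub>i\<close> for certain \<open>g\<^sub>i\<close> (\<open>syzygy_log\<close>), and it is \<open>(x g\<^sub>1, y g\<^sub>2, z g\<^sub>3)\<close>.
  The \<open>g\<^sub>i\<close> are subject to \<open>\<Sum> g\<^sub>i = 0\<close> and to one linear equation for each \<open>j \<ge> 4\<close>, whose coefficients are
  those of \<open>\<rho>\<^sub>j\<close>. So \<open>D\<^sub>0(F)\<close> is the kernel of the transpose of the relation matrix, and the sequence is a
  Buchsbaum-Rim complex. Such a complex is exact if the maximal minors of the matrix generate an ideal of
  codimension three. The minors are \<open>det(dF, df\<^sub>i, df\<^sub>j) / (f\<^sub>i f\<^sub>j)\<close>, and the proof of exactness is made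
  explicit for them.

  First, the minors annihilate the homology. For generation this is a Cramer relation between \<open>\<theta>\<close>, \<open>\<omega>\<^sub>i\<close>
  and \<open>\<omega>\<^sub>j\<close> (\<open>minor_mult_syzygy\<close>). For relations it holds because the Cramer relation between three of the
  \<open>\<omega>\<close>'s is an explicit combination of the \<open>\<rho>\<^sub>j\<close> (\<open>pluecker_relation\<close>, \<open>minor_mult_relation\<close>).

  Second, because of normal crossings the minors have no common zero in \<open>\<P>\<^sup>2\<close> (\<open>minors_no_common_zero\<close>). By
  the Nullstellensatz (\<open>homogeneous_nullstellensatz\<close>), which is proved from the uncountability of \<open>\<complex>\<close>, some
  powers \<open>x\<^sup>N\<close>, \<open>y\<^sup>N\<close>, \<open>z\<^sup>N\<close> annihilate the homology.

  Third, homology of so short a complex of free modules is zero as soon as it is killed by a regular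
  sequence: two elements suffice at \<open>S\<^sup>m\<^sup>-\<^sup>1\<close> (\<open>mem_image_if_coprime_multiples\<close>) and three at \<open>D\<^sub>0(F)\<close>
  (\<open>mem_image_if_regular_multiples\<close>). Injectivity of the first map follows from Euler's formula
  (\<open>rho_map_inj\<close>).

  The resolution of \<open>M(F)\<close> is obtained by splicing with \<open>S\<^sup>3 \<rightarrow> S\<close>. Both resolutions are minimal, because
  the entries of all matrices are homogeneous of positive degree.
\<close>

section \<open>Polynomials in three variables\<close>

definition const :: "complex \<Rightarrow> mpoly" where "const c = [:[:[:c:]:]:]"

lemma mpoly_eqI: "(\<And>i j k. mcoeff p i j k = mcoeff q i j k) \<Longrightarrow> p = q"
  by (intro poly_eqI) (simp add: mcoeff_def)

lemma mcoeff_linear [simp]: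
  "mcoeff 0 i j k = 0" "mcoeff (p + q) i j k = mcoeff p i j k + mcoeff q i j k"
  "mcoeff (p - q) i j k = mcoeff p i j k - mcoeff q i j k" "mcoeff (- p) i j k = - mcoeff p i j k"
  "mcoeff (sum g A) i j k = (\<Sum>a\<in>A. mcoeff (g a) i j k)"
  "mcoeff (const c * p) i j k = c * mcoeff p i j k"
  by (simp_all add: mcoeff_def const_def coeff_sum)

lemma mcoeff_mult:
  "mcoeff (p * q) i j k =
     (\<Sum>k'\<le>k. \<Sum>j'\<le>j. \<Sum>i'\<le>i. mcoeff p i' j' k' * mcoeff q (i - i') (j - j') (k - k'))"
  by (simp add: mcoeff_def coeff_mult coeff_sum)

lemma mcoeff_var_mult [simp]:
  "mcoeff (var_x * p) i j k = (case i of 0 \<Rightarrow> 0 | Suc i' \<Rightarrow> mcoeff p i' j k)"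
  "mcoeff (var_y * p) i j k = (case j of 0 \<Rightarrow> 0 | Suc j' \<Rightarrow> mcoeff p i j' k)"
  "mcoeff (var_z * p) i j k = (case k of 0 \<Rightarrow> 0 | Suc k' \<Rightarrow> mcoeff p i j k')"
  by (simp_all add: mcoeff_def var_x_def var_y_def var_z_def coeff_pCons split: nat.splits)

lemma mcoeff_const [simp]: "mcoeff (const c) i j k = (if i = 0 \<and> j = 0 \<and> k = 0 then c else 0)"
  by (simp add: mcoeff_def const_def coeff_pCons split: nat.splits)

lemma mcoeff_derivatives [simp]:
  "mcoeff (d_x p) i j k = of_nat (Suc i) * mcoeff p (Suc i) j k"
  "mcoeff (d_y p) i j k = of_nat (Suc j) * mcoeff p i (Suc j) k"
  "mcoeff (d_z p) i j k = of_nat (Suc k) * mcoeff p i j (Suc k)"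
  by (simp_all add: mcoeff_def d_x_def d_y_def d_z_def coeff_map_poly coeff_pderiv
      of_nat_poly del: of_nat_Suc)

lemma const_0 [simp]: "const 0 = 0" and const_1 [simp]: "const 1 = 1"
  and const_mult: "const (c * c') = const c * const c'"
  and const_add: "const (c + c') = const c + const c'"
  and const_diff: "const (c - c') = const c - const c'"
  by (simp_all add: const_def one_pCons)

lemma const_dvd_1: "c \<noteq> 0 \<Longrightarrow> const c dvd 1"
  by (rule dvdI[of _ _ "const (inverse c)"]) (simp flip: const_mult)

lemma var_nonzero: "var_x \<noteq> 0" "var_y \<noteq> 0" "var_z \<noteq> 0"
  by (simp_all add: var_x_def var_y_def var_z_def)

section \<open>Homogeneous polynomials\<close>

lemma homogeneous_0 [simp]: "homogeneous n 0"
  by (simp add: homogeneous_def)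

lemma homogeneous_mcoeff_eq_0: "homogeneous n p \<Longrightarrow> int (i + j + k) \<noteq> n \<Longrightarrow> mcoeff p i j k = 0"
  by (auto simp: homogeneous_def)

lemma homogeneous_add: "homogeneous n p \<Longrightarrow> homogeneous n q \<Longrightarrow> homogeneous n (p + q)"
  unfolding homogeneous_def mcoeff_linear by (metis add.right_neutral)

lemma homogeneous_minus: "homogeneous n p \<Longrightarrow> homogeneous n (- p)"
  by (simp add: homogeneous_def)

lemma homogeneous_diff: "homogeneous n p \<Longrightarrow> homogeneous n q \<Longrightarrow> homogeneous n (p - q)"
  using homogeneous_add[of n p "- q"] homogeneous_minus[of n q] by simp

lemma homogeneous_sum: "(\<And>a. a \<in> A \<Longrightarrow> homogeneous n (g a)) \<Longrightarrow> homogeneous n (sum g A)"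
  by (induction A rule: infinite_finite_induct) (auto intro: homogeneous_add)

text \<open>A nonzero coefficient of a product comes from a pair of nonzero coefficients of the factors.\<close>

lemma homogeneous_mult:
  assumes p: "homogeneous a p" and q: "homogeneous b q"
  shows "homogeneous (a + b) (p * q)"
  unfolding homogeneous_def
proof (intro allI impI)
  fix i j k assume nz: "mcoeff (p * q) i j k \<noteq> 0"
  have "\<exists>k'\<le>k. \<exists>j'\<le>j. \<exists>i'\<le>i. mcoeff p i' j' k' * mcoeff q (i - i') (j - j') (k - k') \<noteq> 0"
  proof (rule ccontr)
    assume "\<not> ?thesis"
    then have "mcoeff (p * q) i j k = 0"
      unfolding mcoeff_mult by (intro sum.neutral ballI) auto
    with nz show False ..
  qed
  then obtain i' j' k' where le: "i' \<le> i" "j' \<le> j" "k' \<le> k"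
    and "mcoeff p i' j' k' \<noteq> 0" "mcoeff q (i - i') (j - j') (k - k') \<noteq> 0"
    by auto
  then have "int (i' + j' + k') = a" "int ((i - i') + (j - j') + (k - k')) = b"
    using p q unfolding homogeneous_def by blast+
  then show "int (i + j + k) = a + b"
    using le by linarith
qed

lemma homogeneous_const: "homogeneous 0 (const c)"
  by (simp add: homogeneous_def)

lemma homogeneous_1: "homogeneous 0 1"
  using homogeneous_const[of 1] by simp

lemma homogeneous_prod:
  "(\<And>a. a \<in> A \<Longrightarrow> homogeneous (n a) (g a)) \<Longrightarrow> homogeneous (sum n A) (prod g A)"
  by (induction A rule: infinite_finite_induct) (auto intro: homogeneous_mult homogeneous_1)

lemma homogeneous_var: "homogeneous 1 var_x" "homogeneous 1 var_y" "homogeneous 1 var_z"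
  by (auto simp: homogeneous_def mcoeff_def var_x_def var_y_def var_z_def coeff_pCons
      split: nat.splits if_splits)

lemma homogeneous_derivatives:
  assumes "homogeneous n p"
  shows "homogeneous (n - 1) (d_x p)" "homogeneous (n - 1) (d_y p)" "homogeneous (n - 1) (d_z p)"
  using assms by (force simp: homogeneous_def)+

lemma homogeneous_degree_unique:
  assumes "homogeneous a p" "homogeneous b p" "p \<noteq> 0" shows "a = b"
proof (rule ccontr)
  assume "a \<noteq> b"
  then have "p = 0" using assms(1,2) by (intro mpoly_eqI) (auto simp: homogeneous_def)
  with assms(3) show False ..
qed

lemma homogeneous_degree_0: "homogeneous 0 p \<Longrightarrow> p = const (mcoeff p 0 0 0)"
  by (intro mpoly_eqI) (auto intro: homogeneous_mcoeff_eq_0)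

lemma homogeneous_constant_term: "homogeneous n p \<Longrightarrow> n \<noteq> 0 \<Longrightarrow> mcoeff p 0 0 0 = 0"
  by (rule homogeneous_mcoeff_eq_0) auto

text \<open>The witnesses collect the monomials divisible by \<open>z\<close>, those in \<open>x\<close> and \<open>y\<close> only that are
  divisible by \<open>y\<close>, and the powers of \<open>x\<close>; this splitting lowers the degree of a homogeneous
  polynomial by one. It gives membership in the maximal ideal, and inductions on the degree.\<close>

lemma no_constant_term_decomposition:
  assumes "mcoeff p 0 0 0 = 0"
  obtains a b c where "p = var_x * a + var_y * b + var_z * c"
    and "\<And>n. homogeneous n p \<Longrightarrow> homogeneous (n - 1) a \<and> homogeneous (n - 1) b \<and> homogeneous (n - 1) c"
proof
  let ?a = "[:[:poly_shift 1 (coeff (coeff p 0) 0):]:] :: mpoly"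
  let ?b = "[:poly_shift 1 (coeff p 0):]" and ?c = "poly_shift 1 p"
  have coeffs: "mcoeff ?a i j k = (if j = 0 \<and> k = 0 then mcoeff p (Suc i) 0 0 else 0)"
    "mcoeff ?b i j k = (if k = 0 then mcoeff p i (Suc j) 0 else 0)"
    "mcoeff ?c i j k = mcoeff p i j (Suc k)" for i j k
    by (simp_all add: mcoeff_def coeff_poly_shift coeff_pCons split: nat.splits)
  show "p = var_x * ?a + var_y * ?b + var_z * ?c"
    using assms
    by (intro mpoly_eqI) (simp only: mcoeff_linear mcoeff_var_mult coeffs, simp split: nat.splits)
  show "homogeneous (n - 1) ?a \<and> homogeneous (n - 1) ?b \<and> homogeneous (n - 1) ?c"
    if "homogeneous n p" for n
    using that unfolding homogeneous_def coeffs by force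
qed

lemma euler_formula:
  assumes "homogeneous n p"
  shows "var_x * d_x p + var_y * d_y p + var_z * d_z p = const (of_int n) * p"
proof (rule mpoly_eqI)
  fix i j k
  have "mcoeff (var_x * d_x p + var_y * d_y p + var_z * d_z p) i j k
      = of_nat (i + j + k) * mcoeff p i j k"
    by (auto split: nat.splits simp: algebra_simps)
  also have "\<dots> = of_int n * mcoeff p i j k"
  proof (cases "mcoeff p i j k = 0")
    case False
    then have "n = int (i + j + k)" using assms by (auto simp: homogeneous_def)
    then show ?thesis by simp
  qed auto
  finally show "mcoeff (var_x * d_x p + var_y * d_y p + var_z * d_z p) i j k
      = mcoeff (const (of_int n) * p) i j k" by simp
qed

section \<open>Derivations\<close>

definition derivation :: "('a::comm_ring_1 \<Rightarrow> 'a) \<Rightarrow> bool" where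
  "derivation D \<longleftrightarrow> (\<forall>p q. D (p + q) = D p + D q \<and> D (p * q) = D p * q + p * D q)"

lemma derivation_add: "derivation D \<Longrightarrow> D (p + q) = D p + D q"
  and derivation_mult: "derivation D \<Longrightarrow> D (p * q) = D p * q + p * D q"
  by (simp_all add: derivation_def)

lemma derivation_0: "derivation D \<Longrightarrow> D 0 = 0"
  using derivation_add[of D 0 0] by simp

lemma derivation_1: "derivation D \<Longrightarrow> D 1 = 0"
  using derivation_mult[of D 1 1] by simp

lemma derivation_sum: "derivation D \<Longrightarrow> D (sum g A) = (\<Sum>a\<in>A. D (g a))"
  by (induction A rule: infinite_finite_induct) (auto simp: derivation_0 derivation_add)

lemma derivation_prod:
  assumes "derivation D" "finite A"
  shows "D (prod g A) = (\<Sum>a\<in>A. prod g (A - {a}) * D (g a))"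
  using assms(2)
proof induction
  case empty
  then show ?case by (simp add: derivation_1 assms(1))
next
  case (insert b A)
  have "prod g (insert b A - {a}) = g b * prod g (A - {a})" if "a \<in> A" for a
  proof -
    have "insert b A - {a} = insert b (A - {a})" using that insert by auto
    then show ?thesis using insert by simp
  qed
  then have "(\<Sum>a\<in>A. prod g (insert b A - {a}) * D (g a)) = g b * (\<Sum>a\<in>A. prod g (A - {a}) * D (g a))"
    by (simp add: sum_distrib_left mult.assoc)
  then show ?case using insert by (simp add: derivation_mult assms(1) algebra_simps)
qed

lemma derivation_pderiv: "derivation (pderiv :: 'a::idom poly \<Rightarrow> 'a poly)"
  by (simp add: derivation_def pderiv_add pderiv_mult algebra_simps)

text \<open>The partial derivatives with respect to \<open>x\<close> and \<open>y\<close> act on the coefficients of polynomials in \<open>z\<close>.\<close>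

lemma derivation_map_poly:
  assumes "derivation D"
  shows "derivation (map_poly D)"
proof -
  note [simp] = derivation_0[OF assms] derivation_add[OF assms] derivation_mult[OF assms]
    derivation_sum[OF assms] coeff_map_poly
  have "map_poly D (p + q) = map_poly D p + map_poly D q" for p q
    by (intro poly_eqI) simp
  moreover have "map_poly D (p * q) = map_poly D p * q + p * map_poly D q" for p q
    by (intro poly_eqI) (simp add: coeff_mult sum.distrib)
  ultimately show ?thesis by (simp add: derivation_def)
qed

lemma derivation_partial: "derivation d_x" "derivation d_y" "derivation d_z"
  unfolding d_x_def d_y_def d_z_def by (intro derivation_map_poly derivation_pderiv)+

section \<open>Evaluation\<close>

lemma meval_simps [simp]:
  "meval 0 P = 0" "meval 1 P = 1" "meval (p + q) P = meval p P + meval q P"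
  "meval (p - q) P = meval p P - meval q P" "meval (- p) P = - meval p P"
  "meval (p * q) P = meval p P * meval q P" "meval (const c) P = c"
  by (cases P; simp add: const_def)+

declare meval.simps [simp del]

lemma meval_sum: "meval (sum g A) P = (\<Sum>a\<in>A. meval (g a) P)"
  by (induction A rule: infinite_finite_induct) auto

lemma meval_prod: "meval (prod g A) P = (\<Prod>a\<in>A. meval (g a) P)"
  by (induction A rule: infinite_finite_induct) auto

lemma meval_var [simp]:
  "meval var_x (a, b, c) = a" "meval var_y (a, b, c) = b" "meval var_z (a, b, c) = c"
  by (simp_all add: var_x_def var_y_def var_z_def meval.simps)

lemma derivatives_var [simp]:
  "d_x var_x = 1" "d_y var_x = 0" "d_z var_x = 0"
  "d_x var_y = 0" "d_y var_y = 1" "d_z var_y = 0"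
  "d_x var_z = 0" "d_y var_z = 0" "d_z var_z = 1"
  by (simp_all add: d_x_def d_y_def d_z_def var_x_def var_y_def var_z_def pderiv_pCons
      map_poly_pCons one_pCons)

section \<open>A homogeneous Nullstellensatz\<close>

text \<open>Ideals of the ring structure that a type carries, without a record. For the ring of
  polynomials this is the same as an ideal in the sense of the record ring (\<open>ideal_S_iff\<close>).\<close>

definition ideal_set :: "'a::comm_ring_1 set \<Rightarrow> bool" where
  "ideal_set I \<longleftrightarrow> 0 \<in> I \<and> (\<forall>a\<in>I. \<forall>b\<in>I. a + b \<in> I) \<and> (\<forall>r. \<forall>a\<in>I. r * a \<in> I)"

lemma ideal_set_closed:
  assumes "ideal_set I"
  shows "0 \<in> I" and "a \<in> I \<Longrightarrow> b \<in> I \<Longrightarrow> a + b \<in> I" and "a \<in> I \<Longrightarrow> r * a \<in> I"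
    and "a \<in> I \<Longrightarrow> a * r \<in> I"
  using assms by (simp_all add: ideal_set_def mult.commute[of a r])

lemma ideal_set_diff: "ideal_set I \<Longrightarrow> a \<in> I \<Longrightarrow> b \<in> I \<Longrightarrow> a - b \<in> I"
  using ideal_set_closed(2)[of I a "-1 * b"] ideal_set_closed(3)[of I b "-1"] by simp

lemma ideal_set_sum: "ideal_set I \<Longrightarrow> (\<And>a. a \<in> A \<Longrightarrow> g a \<in> I) \<Longrightarrow> sum g A \<in> I"
  by (induction A rule: infinite_finite_induct) (auto simp: ideal_set_closed)

lemma ideal_set_cong: "ideal_set I \<Longrightarrow> a - b \<in> I \<Longrightarrow> a \<in> I \<longleftrightarrow> b \<in> I"
  using ideal_set_closed(2)[of I "a - b" b] ideal_set_diff[of I a "a - b"] by auto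

text \<open>An ideal that is maximal among those containing no power of \<open>s\<close> exists by Zorn's lemma. It is
  prime, and every element outside it becomes invertible once \<open>s\<close> is inverted. In other words, it
  is a maximal ideal of the localization at \<open>s\<close>, described without localizing.\<close>

lemma prime_ideal_avoiding_powers:
  fixes I :: "'a::comm_ring_1 set"
  assumes I: "ideal_set I" and s: "\<And>n. s ^ n \<notin> I"
  obtains P where "ideal_set P" "I \<subseteq> P" "\<And>n. s ^ n \<notin> P"
    and "\<And>a. a \<notin> P \<Longrightarrow> \<exists>n r. s ^ n - r * a \<in> P"
    and "\<And>a b. a * b \<in> P \<Longrightarrow> a \<in> P \<or> b \<in> P"
proof -
  define \<A> where "\<A> = {J. ideal_set J \<and> I \<subseteq> J \<and> (\<forall>n. s ^ n \<notin> J)}"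
  have "\<exists>P\<in>\<A>. \<forall>Q\<in>\<A>. P \<subseteq> Q \<longrightarrow> Q = P"
  proof (rule subset_Zorn_nonempty)
    show "\<A> \<noteq> {}" using I s by (auto simp: \<A>_def)
  next
    fix \<C> assume C: "\<C> \<noteq> {}" "subset.chain \<A> \<C>"
    then have sub: "\<C> \<subseteq> \<A>" and tot: "\<And>Q Y. Q \<in> \<C> \<Longrightarrow> Y \<in> \<C> \<Longrightarrow> Q \<subseteq> Y \<or> Y \<subseteq> Q"
      by (auto simp: subset.chain_def subset_chain_def)
    have mem: "ideal_set Q" "I \<subseteq> Q" "s ^ n \<notin> Q" if "Q \<in> \<C>" for Q n
      using sub that by (auto simp: \<A>_def)
    have "a + b \<in> \<Union>\<C>" if a: "a \<in> \<Union>\<C>" and b: "b \<in> \<Union>\<C>" for a b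
    proof -
      obtain Q Y where QY: "Q \<in> \<C>" "a \<in> Q" "Y \<in> \<C>" "b \<in> Y" using a b by blast
      then obtain Z where "Z \<in> \<C>" "a \<in> Z" "b \<in> Z" using tot by blast
      then show ?thesis using ideal_set_closed(2)[OF mem(1)] by blast
    qed
    moreover have "0 \<in> \<Union>\<C>" using C(1) mem(1) ideal_set_closed(1) by blast
    moreover have "r * a \<in> \<Union>\<C>" if "a \<in> \<Union>\<C>" for r a
      using that mem(1) ideal_set_closed(3) by blast
    ultimately have "ideal_set (\<Union>\<C>)" unfolding ideal_set_def by blast
    moreover have "I \<subseteq> \<Union>\<C>" using C(1) mem(2) by blast
    ultimately show "\<Union>\<C> \<in> \<A>" using mem(3) by (auto simp: \<A>_def)
  qed
  then obtain P where "P \<in> \<A>" and max: "\<And>Q. Q \<in> \<A> \<Longrightarrow> P \<subseteq> Q \<Longrightarrow> Q = P" by blast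
  then have P: "ideal_set P" "I \<subseteq> P" "\<And>n. s ^ n \<notin> P" by (auto simp: \<A>_def)
  note cl = ideal_set_closed[OF P(1)]
  have meets: "\<exists>n r. s ^ n - r * a \<in> P" if "a \<notin> P" for a
  proof (rule ccontr)
    assume no: "\<not> ?thesis"
    define J where "J = {p + r * a | p r. p \<in> P}"
    have "ideal_set J"
      unfolding ideal_set_def
    proof (intro conjI ballI allI)
      show "0 \<in> J" unfolding J_def using cl(1) by (force intro: exI[of _ 0])
      show "u + v \<in> J" if uv: "u \<in> J" "v \<in> J" for u v
      proof -
        obtain p r p' r' where "p \<in> P" "p' \<in> P" "u = p + r * a" "v = p' + r' * a"
          using uv by (auto simp: J_def)
        then have "p + p' \<in> P" "u + v = (p + p') + (r + r') * a"
          by (auto simp: cl algebra_simps)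
        then show ?thesis unfolding J_def by blast
      qed
      show "q * u \<in> J" if u: "u \<in> J" for q u
      proof -
        obtain p r where "p \<in> P" "u = p + r * a" using u by (auto simp: J_def)
        then have "q * p \<in> P" "q * u = q * p + (q * r) * a"
          by (auto simp: cl algebra_simps)
        then show ?thesis unfolding J_def by blast
      qed
    qed
    moreover have "P \<subseteq> J" unfolding J_def by (force intro: exI[of _ 0])
    moreover have "s ^ n \<notin> J" for n
    proof
      assume "s ^ n \<in> J"
      then obtain p r where "p \<in> P" "s ^ n = p + r * a" by (auto simp: J_def)
      then have "s ^ n - r * a \<in> P" by simp
      with no show False by blast
    qed
    ultimately have "J \<in> \<A>" using P(2) by (auto simp: \<A>_def)
    then have "J = P" using max \<open>P \<subseteq> J\<close> by blast
    moreover have "a \<in> J" unfolding J_def using cl(1) by (force intro: exI[of _ 0] exI[of _ 1])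
    ultimately show False using that by blast
  qed
  \<comment> \<open>If \<open>s\<^sup>n \<equiv> r a\<close> and \<open>s\<^sup>k \<equiv> r' b\<close> modulo \<open>P\<close>, then \<open>s\<^sup>n\<^sup>+\<^sup>k \<equiv> r r' a b\<close>.\<close>
  have "a \<in> P \<or> b \<in> P" if ab: "a * b \<in> P" for a b
  proof (rule ccontr)
    assume "\<not> ?thesis"
    then obtain n r k r' where "s ^ n - r * a \<in> P" "s ^ k - r' * b \<in> P"
      using meets by metis
    then have "(s ^ n - r * a) * s ^ k + (r * a) * (s ^ k - r' * b) + (r * r') * (a * b) \<in> P"
      using cl(4)[of "s ^ n - r * a"] cl(3)[of "s ^ k - r' * b"] cl(3)[OF ab] by (intro cl(2)) auto
    also have "(s ^ n - r * a) * s ^ k + (r * a) * (s ^ k - r' * b) + (r * r') * (a * b) = s ^ (n + k)"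
      by (simp add: algebra_simps power_add)
    finally show False using P(3) by blast
  qed
  with P meets show ?thesis by (rule that)
qed

lemma vector_space_const: "vector_space (\<lambda>c p. const c * p)"
  by standard (simp_all only: const_1 const_mult const_add algebra_simps mult_1_left mult_1_right)

text \<open>The polynomial \<open>q\<close> in one variable, homogenized to degree \<open>N\<close> and evaluated at \<open>(s, t)\<close>: it is
  \<open>s\<^sup>N q(t/s)\<close> without the division.\<close>

definition binary_form :: "mpoly \<Rightarrow> mpoly \<Rightarrow> nat \<Rightarrow> complex poly \<Rightarrow> mpoly" where
  "binary_form s t N q = (\<Sum>i\<le>N. const (coeff q i) * t ^ i * s ^ (N - i))"

lemma binary_form_smult: "binary_form s t N (smult c q) = const c * binary_form s t N q"
  by (simp add: binary_form_def sum_distrib_left const_mult mult.assoc)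

lemma binary_form_sum: "binary_form s t N (sum g A) = (\<Sum>a\<in>A. binary_form s t N (g a))"
proof -
  have "binary_form s t N (p + q) = binary_form s t N p + binary_form s t N q" for p q
    by (simp add: binary_form_def const_add algebra_simps sum.distrib)
  moreover have "binary_form s t N 0 = 0" by (simp add: binary_form_def)
  ultimately show ?thesis by (induction A rule: infinite_finite_induct) auto
qed

lemma binary_form_linear_factor:
  assumes "degree q \<le> N"
  shows "binary_form s t (Suc N) ([:-c, 1:] * q) = (t - const c * s) * binary_form s t N q"
proof -
  have "binary_form s t (Suc N) (pCons 0 q) = t * binary_form s t N q"
    unfolding binary_form_def sum.atMost_Suc_shift by (simp add: sum_distrib_left algebra_simps)
  moreover have "binary_form s t (Suc N) q = s * binary_form s t N q"
  proof -
    have "coeff q (Suc N) = 0" using assms by (intro coeff_eq_0) simp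
    then show ?thesis
      by (simp add: binary_form_def sum_distrib_left Suc_diff_le algebra_simps)
  qed
  moreover have "[:-c, 1:] * q = (\<Sum>b\<in>{True, False}. if b then pCons 0 q else smult (-c) q)"
    by simp
  moreover have "const (- c) = - const c" by (simp add: const_def)
  ultimately show ?thesis
    by (simp only: binary_form_sum) (simp add: binary_form_smult algebra_simps del: smult_minus_left)
qed

lemma binary_form_prod:
  assumes "finite B"
  shows "binary_form s t (card B) (\<Prod>c\<in>B. [:-c, 1:]) = (\<Prod>c\<in>B. t - const c * s)"
  using assms
proof induction
  case (insert c B)
  have "degree (\<Prod>c\<in>B. [:-c, 1:]) \<le> card B"
    using degree_prod_sum_le[OF insert(1), of "\<lambda>c. [:-c, 1:]"] by simp
  then have "binary_form s t (Suc (card B)) ([:-c, 1:] * (\<Prod>c\<in>B. [:-c, 1:]))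
      = (t - const c * s) * (\<Prod>c\<in>B. t - const c * s)"
    by (simp only: binary_form_linear_factor insert.IH)
  then show ?case using insert(1,2) by (simp only: card_insert_disjoint prod.insert not_False_eq_True)
qed (simp add: binary_form_def)

text \<open>Over \<open>\<complex>\<close> a binary form is a product of linear forms, and a prime ideal contains one of them. The
  factors that are multiples of \<open>s\<close> are excluded, so a factor \<open>t - c s\<close> remains.\<close>

lemma linear_factor_in_prime_ideal:
  assumes s: "\<And>n. s ^ n \<notin> P" and prime: "\<And>a b. a * b \<in> P \<Longrightarrow> a \<in> P \<or> b \<in> P"
    and "ideal_set P"
  shows "q \<noteq> 0 \<Longrightarrow> degree q \<le> N \<Longrightarrow> binary_form s t N q \<in> P \<Longrightarrow> \<exists>c. t - const c * s \<in> P"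
proof (induction "degree q" arbitrary: q N)
  case 0
  then obtain a where q: "q = [:a:]" "a \<noteq> 0" by (metis degree_eq_zeroE pCons_eq_0_iff)
  have "binary_form s t N q = const a * s ^ N"
    by (simp add: binary_form_def q coeff_pCons nat.case_eq_if sum.delta if_distrib sum.atMost_shift)
  then have "const (inverse a) * (const a * s ^ N) \<in> P"
    using 0 ideal_set_closed(3)[OF assms(3)] by simp
  then show ?case using s q(2) by (simp flip: mult.assoc const_mult)
next
  case (Suc k)
  then have "\<not> constant (poly q)" by (simp add: constant_degree)
  then obtain c where "poly q c = 0" using fundamental_theorem_of_algebra by blast
  then obtain q' where q': "q = [:-c, 1:] * q'" by (metis poly_eq_0_iff_dvd dvdE)
  with Suc have "q' \<noteq> 0" by auto
  then have deg: "degree q' = k" using Suc(2) unfolding q'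
    by (simp add: degree_mult_eq del: mult_pCons_left)
  then obtain N' where N: "N = Suc N'" "degree q' \<le> N'" using Suc by (cases N) auto
  then have "(t - const c * s) * binary_form s t N' q' \<in> P"
    using Suc(5) unfolding q' by (simp only: binary_form_linear_factor)
  then show ?case using prime Suc(1)[OF deg[symmetric] \<open>q' \<noteq> 0\<close> N(2)] by blast
qed

lemma mpoly_in_finite_monomial_span:
  fixes p :: mpoly
  shows "\<exists>T. finite T \<and> T \<subseteq> range (\<lambda>(i, j, k). var_x ^ i * var_y ^ j * var_z ^ k)
    \<and> p \<in> module.span (\<lambda>c p. const c * p) T"
proof -
  interpret V: vector_space "\<lambda>c p. const c * p" by (rule vector_space_const)
  let ?m = "\<lambda>(i, j, k). var_x ^ i * var_y ^ j * var_z ^ k :: mpoly"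
  let ?M = "range ?m"
  have mult: "v * u \<in> V.span ?M" if "\<And>w. w \<in> ?M \<Longrightarrow> v * w \<in> ?M" "u \<in> V.span ?M" for v u
    using that(2)
  proof (induction rule: V.span_induct_alt)
    case base show ?case by (simp add: V.span_zero)
  next
    case (step c x y)
    have "v * (const c * x + y) = const c * (v * x) + v * y" by (simp add: algebra_simps)
    with step that(1) show ?case
      by (metis V.span_add V.span_base V.span_scale)
  qed
  have "var_x * w \<in> ?M \<and> var_y * w \<in> ?M \<and> var_z * w \<in> ?M" if "w \<in> ?M" for w
  proof -
    obtain i j k where w: "w = var_x ^ i * var_y ^ j * var_z ^ k" using \<open>w \<in> ?M\<close> by auto
    have "var_x * w = var_x ^ Suc i * var_y ^ j * var_z ^ k"
      "var_y * w = var_x ^ i * var_y ^ Suc j * var_z ^ k"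
      "var_z * w = var_x ^ i * var_y ^ j * var_z ^ Suc k"
      by (simp_all only: w power_Suc ac_simps)
    then show ?thesis
      using rangeI[of ?m "(Suc i, j, k)"] rangeI[of ?m "(i, Suc j, k)"] rangeI[of ?m "(i, j, Suc k)"]
      by (simp only: case_prod_conv)
  qed
  then have *: "w \<in> ?M \<Longrightarrow> var_x * w \<in> ?M" "w \<in> ?M \<Longrightarrow> var_y * w \<in> ?M" "w \<in> ?M \<Longrightarrow> var_z * w \<in> ?M" for w
    by blast+
  have x: "u \<in> V.span ?M \<Longrightarrow> var_x * u \<in> V.span ?M"
    and y: "u \<in> V.span ?M \<Longrightarrow> var_y * u \<in> V.span ?M"
    and z: "u \<in> V.span ?M \<Longrightarrow> var_z * u \<in> V.span ?M" for u
    by (rule mult[OF *(1)] mult[OF *(2)] mult[OF *(3)]; assumption)+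
  have "const c \<in> V.span ?M" for c
  proof -
    have "1 \<in> ?M" by (rule range_eqI[of _ _ "(0, 0, 0)"]) simp
    then show ?thesis using V.span_scale[OF V.span_base, of 1 ?M c] by simp
  qed
  note const = this
  have 1: "[:[:q:]:] \<in> V.span ?M" for q
  proof (induction q)
    case (pCons c q)
    have "[:[:pCons c q:]:] = const c + var_x * [:[:q:]:]" by (simp add: const_def var_x_def)
    then show ?case using V.span_add[OF const[of c] x[OF pCons(2)]] by (simp only:)
  qed (simp add: V.span_zero)
  have 2: "[:q:] \<in> V.span ?M" for q
  proof (induction q)
    case (pCons c q)
    have "[:pCons c q:] = [:[:c:]:] + var_y * [:q:]" by (simp add: var_y_def)
    then show ?case using V.span_add[OF 1[of c] y[OF pCons(2)]] by (simp only:)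
  qed (simp add: V.span_zero)
  have "p \<in> V.span ?M"
  proof (induction p)
    case (pCons c q)
    have "pCons c q = [:c:] + var_z * q" by (simp add: var_z_def)
    then show ?case using V.span_add[OF 2[of c] z[OF pCons(2)]] by (simp only:)
  qed (rule V.span_zero)
  then obtain T r where "finite T" "T \<subseteq> ?M" "p = (\<Sum>a\<in>T. const (r a) * a)"
    unfolding V.span_explicit by blast
  moreover from this have "p \<in> V.span T" by (auto intro!: V.span_sum V.span_scale intro: V.span_base)
  ultimately show ?thesis by blast
qed

text \<open>This replaces Zariski's lemma. If no \<open>t - c s\<close> were in \<open>P\<close>, each would be invertible modulo \<open>P\<close> and
  up to powers of \<open>s\<close>, with inverse \<open>r c\<close>. There are uncountably many \<open>c\<close>, but the polynomials have
  countable dimension over \<open>\<complex>\<close>, so finitely many of the inverses are linearly dependent. Clearing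
  denominators, as for partial fractions, gives a nonzero binary form in \<open>s\<close> and \<open>t\<close> that lies in
  \<open>P\<close>, and hence a linear one.\<close>

lemma ex_linear_relation_modulo_prime:
  fixes P :: "mpoly set"
  assumes P: "ideal_set P" "\<And>n. s ^ n \<notin> P"
    and inv: "\<And>a. a \<notin> P \<Longrightarrow> \<exists>n r. s ^ n - r * a \<in> P"
    and prime: "\<And>a b. a * b \<in> P \<Longrightarrow> a \<in> P \<or> b \<in> P"
  shows "\<exists>c. t - const c * s \<in> P"
proof (rule ccontr)
  assume no: "\<not> ?thesis"
  interpret V: vector_space "\<lambda>c p. const c * p" by (rule vector_space_const)
  note cl = ideal_set_closed[OF P(1)]
  define L where "L c = t - const c * s" for c
  define M :: "mpoly set" where "M = range (\<lambda>(i, j, k). var_x ^ i * var_y ^ j * var_z ^ k)"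
  have "countable M" unfolding M_def by simp
  have L: "L c \<notin> P" for c using no by (auto simp: L_def)
  then have "\<forall>c. \<exists>n r. s ^ n - r * L c \<in> P" using inv by blast
  then obtain n r where r: "\<And>c. s ^ n c - r c * L c \<in> P" by metis
  have "\<forall>c. \<exists>T. finite T \<and> T \<subseteq> M \<and> r c \<in> V.span T"
    using mpoly_in_finite_monomial_span unfolding M_def by blast
  then obtain T where T: "\<And>c. finite (T c)" "\<And>c. T c \<subseteq> M" "\<And>c. r c \<in> V.span (T c)" by metis
  \<comment> \<open>An exponent together with a finite set of monomials: only countably many values are possible, so
    some value is taken for infinitely many \<open>c\<close>.\<close>
  define h where "h c = (n c, T c)" for c
  have "range h \<subseteq> UNIV \<times> {A. finite A \<and> A \<subseteq> M}" using T by (auto simp: h_def)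
  then have ch: "countable (range h)"
    by (rule countable_subset) (intro countable_SIGMA countable_Collect_finite_subset \<open>countable M\<close> countableI_type)
  have "\<exists>y\<in>range h. infinite (h -` {y})"
  proof (rule ccontr)
    assume "\<not> ?thesis"
    then have "countable (\<Union>y\<in>range h. h -` {y})"
      by (intro countable_UN[OF ch]) (auto intro: countable_finite)
    moreover have "(\<Union>y\<in>range h. h -` {y}) = UNIV" by auto
    ultimately show False using uncountable_UNIV_complex by simp
  qed
  then obtain N T' where K: "infinite (h -` {(N, T')})" by (metis surj_pair)
  define K where "K = h -` {(N, T')}"
  have "infinite K" using K by (simp add: K_def)
  have K: "s ^ N - r c * L c \<in> P" "r c \<in> V.span T'" if "c \<in> K" for c
    using r[of c] T(3)[of c] that by (auto simp: K_def h_def)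
  have "finite T'" using \<open>infinite K\<close> T(1) unfolding K_def h_def
    by (metis (mono_tags, lifting) Pair_inject finite.emptyI ex_in_conv vimage_singleton_eq)
  \<comment> \<open>Equal inverses for \<open>c \<noteq> c'\<close> would put \<open>(c - c') s r c\<close>, hence \<open>r c\<close>, hence a power of \<open>s\<close> into \<open>P\<close>.\<close>
  have inj: "inj_on r K"
  proof (rule inj_onI, rule ccontr)
    fix c c' assume cc: "c \<in> K" "c' \<in> K" "r c = r c'" "c \<noteq> c'"
    have "s ^ N - r c * L c' \<in> P" using K(1)[OF cc(2)] cc(3) by simp
    with K(1)[OF cc(1)] have "(s ^ N - r c * L c) - (s ^ N - r c * L c') \<in> P"
      by (rule ideal_set_diff[OF P(1)])
    also have "(s ^ N - r c * L c) - (s ^ N - r c * L c') = const (c - c') * (r c * s)"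
      by (simp add: L_def const_diff algebra_simps)
    finally have "const (inverse (c - c')) * (const (c - c') * (r c * s)) \<in> P" by (rule cl)
    then have "r c * s \<in> P" using cc(4) by (simp flip: mult.assoc const_mult)
    then have "r c \<in> P" using prime P(2)[of 1] by auto
    then have "r c * L c \<in> P" by (rule cl)
    then have "s ^ N \<in> P" using ideal_set_cong[OF P(1) K(1)[OF cc(1)]] by blast
    then show False using P(2) by blast
  qed
  have "V.dependent (r ` K)"
  proof (rule ccontr)
    assume "\<not> V.dependent (r ` K)"
    then have "finite (r ` K)"
      using V.independent_span_bound[OF \<open>finite T'\<close>, of "r ` K"] K(2) by auto
    then show False using \<open>infinite K\<close> inj finite_image_iff by blast
  qed
  then obtain W u where W: "finite W" "W \<subseteq> r ` K" "(\<Sum>v\<in>W. const (u v) * v) = 0" "\<exists>v\<in>W. u v \<noteq> 0"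
    unfolding V.dependent_explicit by blast
  define A where "A = {c \<in> K. r c \<in> W}"
  have rA: "W = r ` A" "inj_on r A" using W(2) inj by (auto simp: A_def inj_on_def)
  then have finA: "finite A" using W(1) finite_image_iff by blast
  define l where "l c = u (r c)" for c
  have rel: "(\<Sum>c\<in>A. const (l c) * r c) = 0"
    using W(3) unfolding rA(1) l_def by (simp add: sum.reindex rA(2))
  obtain c0 where c0: "c0 \<in> A" "l c0 \<noteq> 0" using W(4) rA(1) by (auto simp: l_def)
  \<comment> \<open>The numerator of \<open>\<Sum> l c / (T - c)\<close>. It does not vanish at a point \<open>c0\<close> with \<open>l c0 \<noteq> 0\<close>.\<close>
  define q where "q = (\<Sum>c\<in>A. smult (l c) (\<Prod>k\<in>A - {c}. [:-k, 1:]))"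
  have deg: "degree (\<Prod>k\<in>A - {c}. [:-k, 1:]) \<le> card A - 1" if "c \<in> A" for c
    using degree_prod_sum_le[of "A - {c}" "\<lambda>c. [:-c, 1:]"] finA that by simp
  then have "degree q \<le> card A - 1"
    unfolding q_def by (intro degree_sum_le finA) (auto intro: order.trans[OF degree_smult_le])
  moreover have "q \<noteq> 0"
  proof -
    have "poly q c0 = (\<Sum>c\<in>A. l c * (\<Prod>k\<in>A - {c}. c0 - k))"
      by (simp add: q_def poly_sum poly_prod)
    also have "\<dots> = (\<Sum>c\<in>A. if c = c0 then l c0 * (\<Prod>k\<in>A - {c0}. c0 - k) else 0)"
      using c0 finA by (intro sum.cong) auto
    also have "\<dots> = l c0 * (\<Prod>k\<in>A - {c0}. c0 - k)" using c0 finA by simp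
    also have "\<dots> \<noteq> 0" using c0 finA by simp
    finally show ?thesis by auto
  qed
  moreover have "binary_form s t (card A - 1) q \<in> P"
  proof -
    have "binary_form s t (card A - 1) q = (\<Sum>c\<in>A. const (l c) * (\<Prod>k\<in>A - {c}. L k))"
      unfolding q_def binary_form_sum binary_form_smult
    proof (rule sum.cong[OF refl])
      fix c assume "c \<in> A"
      then have "card A - 1 = card (A - {c})" using finA by simp
      then show "const (l c) * binary_form s t (card A - 1) (\<Prod>k\<in>A - {c}. [:-k, 1:])
          = const (l c) * (\<Prod>k\<in>A - {c}. L k)"
        using finA by (simp only: L_def binary_form_prod finite_Diff)
    qed
    note form = this
    have "binary_form s t (card A - 1) q * s ^ N
        = (\<Sum>c\<in>A. const (l c) * (\<Prod>k\<in>A - {c}. L k) * (s ^ N - r c * L c))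
          + (\<Sum>c\<in>A. const (l c) * ((\<Prod>k\<in>A - {c}. L k) * L c) * r c)"
      unfolding form sum_distrib_right sum.distrib[symmetric]
      by (intro sum.cong) (simp_all add: algebra_simps)
    also have "(\<Sum>c\<in>A. const (l c) * ((\<Prod>k\<in>A - {c}. L k) * L c) * r c)
        = (\<Prod>k\<in>A. L k) * (\<Sum>c\<in>A. const (l c) * r c)"
      unfolding sum_distrib_left
      by (intro sum.cong) (simp_all add: prod.remove[OF finA] ac_simps)
    finally have "binary_form s t (card A - 1) q * s ^ N
        = (\<Sum>c\<in>A. const (l c) * (\<Prod>k\<in>A - {c}. L k) * (s ^ N - r c * L c))"
      by (simp add: rel)
    also have "\<dots> \<in> P" using K(1) by (intro ideal_set_sum P cl) (auto simp: A_def)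
    finally show ?thesis using prime P(2) by blast
  qed
  ultimately show False
    using linear_factor_in_prime_ideal[OF P(2) prime P(1)] no by blast
qed

text \<open>If no power of \<open>s\<close> were in \<open>I\<close>, take a prime ideal \<open>P\<close> as above. Modulo \<open>P\<close> each variable is a
  scalar multiple of \<open>s\<close>, with scalars \<open>(a, b, c)\<close>, so a homogeneous \<open>u\<close> of degree \<open>n\<close> is congruent
  to \<open>u(a, b, c) s\<^sup>n\<close>. Hence all elements of \<open>U\<close> vanish at \<open>(a, b, c)\<close>; this point is not the origin,
  since otherwise \<open>s\<close> itself would be in \<open>P\<close>.\<close>

lemma homogeneous_nullstellensatz:
  assumes I: "ideal_set I" "U \<subseteq> I" and hom: "\<And>u. u \<in> U \<Longrightarrow> \<exists>n. homogeneous n u"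
    and zeros: "\<And>Q. Q \<noteq> (0, 0, 0) \<Longrightarrow> \<exists>u\<in>U. meval u Q \<noteq> 0"
    and s: "s \<in> {var_x, var_y, var_z}"
  shows "\<exists>n. s ^ n \<in> I"
proof (rule ccontr)
  assume "\<not> ?thesis"
  then obtain P where P: "ideal_set P" "I \<subseteq> P" "\<And>n. s ^ n \<notin> P"
    and inv: "\<And>a. a \<notin> P \<Longrightarrow> \<exists>n r. s ^ n - r * a \<in> P"
    and prime: "\<And>a b. a * b \<in> P \<Longrightarrow> a \<in> P \<or> b \<in> P"
    using prime_ideal_avoiding_powers[OF I(1), of s] by (metis (no_types, lifting))
  note cl = ideal_set_closed[OF P(1)]
  obtain a b c where lin: "var_x - const a * s \<in> P" "var_y - const b * s \<in> P" "var_z - const c * s \<in> P"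
    using ex_linear_relation_modulo_prime[OF P(1,3) inv prime] by metis
  have val: "u - const (meval u (a, b, c)) * s ^ n \<in> P" if "homogeneous (int n) u" for n u
    using that
  proof (induction n arbitrary: u)
    case 0
    then obtain k where "u = const k" using homogeneous_degree_0 by auto
    then show ?case by (simp add: cl del: meval.simps)
  next
    case (Suc n)
    have "mcoeff u 0 0 0 = 0" using Suc.prems by (rule homogeneous_constant_term) simp
    then obtain u1 u2 u3 where u: "u = var_x * u1 + var_y * u2 + var_z * u3"
      and "\<And>n. homogeneous n u \<Longrightarrow> homogeneous (n - 1) u1 \<and> homogeneous (n - 1) u2 \<and> homogeneous (n - 1) u3"
      by (rule no_constant_term_decomposition) blast
    with Suc.prems have "homogeneous (int n) u1" "homogeneous (int n) u2" "homogeneous (int n) u3"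
      by force+
    note IH = this[THEN Suc.IH]
    let ?e = "\<lambda>v. const (meval v (a, b, c))"
    have "(var_x - const a * s) * u1 + (var_y - const b * s) * u2 + (var_z - const c * s) * u3
        + (const a * s * (u1 - ?e u1 * s ^ n) + const b * s * (u2 - ?e u2 * s ^ n)
          + const c * s * (u3 - ?e u3 * s ^ n)) \<in> P" (is "?l \<in> P")
      by (intro cl(2); (rule lin[THEN cl(4)] IH[THEN cl(3)]))
    also have "?l = u - ?e u * s ^ Suc n"
      by (simp add: u const_add const_mult algebra_simps)
    finally show ?case .
  qed
  have "(a, b, c) \<noteq> (0, 0, 0)"
  proof
    assume "(a, b, c) = (0, 0, 0)"
    then have "s ^ 1 \<in> P" using lin s by auto
    then show False using P(3) by blast
  qed
  then obtain u where u: "u \<in> U" "meval u (a, b, c) \<noteq> 0" using zeros by blast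
  then obtain n where "homogeneous n u" using hom by blast
  moreover have "n \<ge> 0"
  proof (rule ccontr)
    assume "\<not> n \<ge> 0"
    then have "u = 0" using \<open>homogeneous n u\<close>
      by (intro mpoly_eqI) (auto intro: homogeneous_mcoeff_eq_0)
    then show False using u(2) by simp
  qed
  ultimately have "u - const (meval u (a, b, c)) * s ^ nat n \<in> P" using val by simp
  moreover have "u \<in> P" using u(1) I(2) P(2) by blast
  ultimately have "const (meval u (a, b, c)) * s ^ nat n \<in> P"
    using ideal_set_cong[OF P(1)] by blast
  then have "const (inverse (meval u (a, b, c))) * (const (meval u (a, b, c)) * s ^ nat n) \<in> P"
    by (rule cl)
  then show False using u(2) P(3) by (simp flip: mult.assoc const_mult)
qed

section \<open>Vector algebra\<close>

definition det3 :: "triple \<Rightarrow> triple \<Rightarrow> triple \<Rightarrow> mpoly" where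
  "det3 u v w = (case u of (u1, u2, u3) \<Rightarrow> case wedge v w of (c1, c2, c3) \<Rightarrow>
     u1 * c1 + u2 * c2 + u3 * c3)"

lemma det3_simp:
  "det3 (u1, u2, u3) (v1, v2, v3) (w1, w2, w3) =
     u1 * (v2 * w3 - v3 * w2) - u2 * (v1 * w3 - v3 * w1) + u3 * (v1 * w2 - v2 * w1)"
  by (simp add: det3_def algebra_simps)

lemma det3_repeat [simp]: "det3 u u v = 0" "det3 u v u = 0" "det3 u v v = 0"
  by (cases u; cases v; simp add: det3_simp algebra_simps)+

lemma det3_rotate: "det3 u v w = det3 v w u" and det3_swap: "det3 u v w = - det3 u w v"
  by (cases u; cases v; cases w; simp add: det3_simp algebra_simps)+

lemma tsmult_simps:
  "p \<bullet> (s + t) = p \<bullet> s + p \<bullet> t" "(p + q) \<bullet> t = p \<bullet> t + q \<bullet> t" "(p * q) \<bullet> t = p \<bullet> q \<bullet> t"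
  "(p - q) \<bullet> t = p \<bullet> t - q \<bullet> t" "p \<bullet> (s - t) = p \<bullet> s - p \<bullet> t" "(- p) \<bullet> t = - (p \<bullet> t)" "p \<bullet> (- t) = - (p \<bullet> t)"
  "0 \<bullet> t = 0" "1 \<bullet> t = t" "p \<bullet> (0 :: triple) = 0"
  by (cases s; cases t; simp add: algebra_simps zero_prod_def)+

lemma tsmult_sum: "p \<bullet> sum g A = (\<Sum>a\<in>A. p \<bullet> g a)" and sum_tsmult: "sum h A \<bullet> t = (\<Sum>a\<in>A. h a \<bullet> t)"
  by (induction A rule: infinite_finite_induct) (auto simp: tsmult_simps)

lemma tsmult_cancel: "p \<noteq> 0 \<Longrightarrow> p \<bullet> s = p \<bullet> t \<Longrightarrow> s = t"
  by (cases s; cases t) auto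

lemma tsmult_commute: "p \<bullet> q \<bullet> t = q \<bullet> p \<bullet> t"
  by (cases t) (simp add: mult.left_commute)

definition dot :: "triple \<Rightarrow> triple \<Rightarrow> mpoly" where
  "dot s t = (case s of (a, b, c) \<Rightarrow> case t of (p, q, r) \<Rightarrow> a * p + b * q + c * r)"

lemma dot_linear:
  "dot (s + t) u = dot s u + dot t u" "dot (p \<bullet> s) u = p * dot s u"
  "dot u (s + t) = dot u s + dot u t" "dot u (p \<bullet> s) = p * dot u s" "dot 0 u = 0" "dot u 0 = 0"
  by (cases s; cases t; cases u; simp add: dot_def algebra_simps zero_prod_def)+

lemma dot_sum: "dot (sum g A) u = (\<Sum>a\<in>A. dot (g a) u)" "dot u (sum g A) = (\<Sum>a\<in>A. dot u (g a))"
  by (induction A rule: infinite_finite_induct) (auto simp: dot_linear)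

lemma dot_wedge: "dot u (wedge v w) = det3 u v w"
  by (cases u; cases v; cases w) (simp add: det3_simp dot_def algebra_simps)

lemma wedge_linear:
  "wedge (s + t) u = wedge s u + wedge t u" "wedge (p \<bullet> s) u = p \<bullet> wedge s u" "wedge u u = 0" "wedge 0 u = 0"
  by (cases s; cases t; cases u; simp add: algebra_simps zero_prod_def)+

lemma wedge_swap: "wedge s u = - wedge u s"
  by (cases s; cases u; simp add: algebra_simps)

lemma wedge_sum: "wedge (sum g A) u = (\<Sum>a\<in>A. wedge (g a) u)"
  by (induction A rule: infinite_finite_induct) (auto simp: wedge_linear(1,4))

text \<open>The expansion of the double vector product \<open>g \<times> (\<theta> \<times> (u \<times> v))\<close>.\<close>

lemma double_wedge:
  "det3 g u v \<bullet> \<theta> = dot \<theta> v \<bullet> wedge g u - dot \<theta> u \<bullet> wedge g v + dot \<theta> g \<bullet> wedge u v"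
  by (cases g; cases u; cases v; cases \<theta>) (simp add: det3_simp dot_def algebra_simps)

text \<open>Cramer's rule, for the expansion of \<open>t\<close> in terms of \<open>n\<close>, \<open>k\<close>, \<open>l\<close>.\<close>

lemma det3_cramer:
  "det3 t k l \<bullet> n + det3 t l n \<bullet> k + det3 t n k \<bullet> l = det3 n k l \<bullet> t"
  by (cases t; cases k; cases l; cases n) (simp add: det3_simp algebra_simps)

section \<open>The forms and the minors of the relation matrix\<close>

locale arrangement =
  fixes m :: nat and f :: "nat \<Rightarrow> mpoly"
  assumes m: "m \<ge> 4"
    and f123: "f 1 = var_x" "f 2 = var_y" "f 3 = var_z"
    and f_nz: "\<And>j. j \<in> {1..m} \<Longrightarrow> f j \<noteq> 0"
begin

abbreviation "grad i \<equiv> ext_d (f i)"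

lemma grad_123: "grad 1 = (1, 0, 0)" "grad 2 = (0, 1, 0)" "grad 3 = (0, 0, 1)"
  by (simp_all only: f123 ext_d_def derivatives_var)

text \<open>The quotient of the product of all \<open>f\<^sub>k\<close> by those with \<open>k \<in> T\<close>; all divisions below are expressed
  in this way.\<close>

definition cofactor :: "nat set \<Rightarrow> mpoly" where
  "cofactor T = (\<Prod>k\<in>{1..m} - T. f k)"

abbreviation "fprod \<equiv> cofactor {}"

text \<open>The quotient \<open>det(dF, df\<^sub>i, df\<^sub>j) / (f\<^sub>i f\<^sub>j)\<close>, see \<open>det_grad_fprod\<close>. Up to sign it is also the
  maximal minor, with the columns \<open>i\<close> and \<open>j\<close> deleted, of the matrix with \<open>m\<close> columns whose rows are
  \<open>(1, \<dots>, 1)\<close> and the relations \<open>\<rho>\<^sub>j\<close> for \<open>j \<ge> 4\<close>, written in terms of all of \<open>\<omega>\<^sub>1, \<dots>, \<omega>\<^sub>m\<close>.\<close>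

definition minor :: "nat \<Rightarrow> nat \<Rightarrow> mpoly" where
  "minor i j = (\<Sum>n\<in>{1..m} - {i, j}. cofactor {n, i, j} * det3 (grad n) (grad i) (grad j))"

lemma cofactor_insert: "n \<in> {1..m} \<Longrightarrow> n \<notin> T \<Longrightarrow> cofactor T = f n * cofactor (insert n T)"
proof -
  assume n: "n \<in> {1..m}" "n \<notin> T"
  have diff: "{1..m} - insert n T = ({1..m} - T) - {n}" by auto
  show ?thesis unfolding cofactor_def diff by (rule prod.remove) (use n in auto)
qed

text \<open>Moves \<open>f\<^sub>k\<close> out of a logarithmic sum \<open>\<Sum> g\<^sub>n / f\<^sub>n\<close> that has no pole along \<open>f\<^sub>k\<close>.\<close>

lemma cofactor_sum_factor:
  assumes "k \<in> {1..m}" "k \<notin> T" "g k = 0"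
  shows "(\<Sum>n\<in>{1..m} - T. cofactor (insert n T) * g n)
    = f k * (\<Sum>n\<in>{1..m} - insert k T. cofactor (insert n (insert k T)) * g n)"
proof -
  have "(\<Sum>n\<in>{1..m} - T. cofactor (insert n T) * g n)
      = (\<Sum>n\<in>{1..m} - insert k T. cofactor (insert n T) * g n)"
    by (rule sum.mono_neutral_right) (use assms in auto)
  also have "\<dots> = (\<Sum>n\<in>{1..m} - insert k T. f k * (cofactor (insert n (insert k T)) * g n))"
  proof (rule sum.cong[OF refl])
    fix n assume n: "n \<in> {1..m} - insert k T"
    then have "cofactor (insert n T) = f k * cofactor (insert k (insert n T))"
      using assms by (intro cofactor_insert) auto
    then show "cofactor (insert n T) * g n = f k * (cofactor (insert n (insert k T)) * g n)"
      by (simp add: insert_commute mult.assoc)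
  qed
  finally show ?thesis by (simp add: sum_distrib_left)
qed

lemma grad_fprod: "ext_d fprod = (\<Sum>n\<in>{1..m}. cofactor {n} \<bullet> grad n)"
proof -
  have "fprod = (\<Prod>k\<in>{1..m}. f k)" by (simp add: cofactor_def)
  then show ?thesis
    by (simp add: prod_eq_iff ext_d_def fst_sum snd_sum derivation_prod derivation_partial cofactor_def)
qed

lemma det_grad_fprod:
  assumes "i \<in> {1..m}" "j \<in> {1..m}" "i \<noteq> j"
  shows "det3 (ext_d fprod) (grad i) (grad j) = f i * f j * minor i j"
proof -
  have "det3 (ext_d fprod) (grad i) (grad j) = dot (ext_d fprod) (wedge (grad i) (grad j))"
    by (simp add: dot_wedge)
  also have "\<dots> = (\<Sum>n\<in>{1..m} - {}. cofactor (insert n {}) * det3 (grad n) (grad i) (grad j))"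
    unfolding grad_fprod dot_sum dot_linear by (simp only: dot_wedge Diff_empty)
  also have "\<dots> = f i * (\<Sum>n\<in>{1..m} - {i}. cofactor (insert n {i}) * det3 (grad n) (grad i) (grad j))"
    using assms by (subst cofactor_sum_factor[of i]) auto
  also have "\<dots> = f i * (f j * (\<Sum>n\<in>{1..m} - {j, i}. cofactor (insert n {j, i}) * det3 (grad n) (grad i) (grad j)))"
    using assms by (subst cofactor_sum_factor[of j]) auto
  finally show ?thesis by (simp add: minor_def insert_commute mult.assoc)
qed

lemma omega_eq: "omega m f j = (\<Sum>n\<in>{1..m} - {j}. cofactor {n, j} \<bullet> wedge (grad n) (grad j))"
  by (simp add: omega_def cofactor_def)

lemma omega_scaled:
  assumes "j \<in> {1..m}"
  shows "f j \<bullet> omega m f j = wedge (ext_d fprod) (grad j)"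
proof -
  have "wedge (ext_d fprod) (grad j) = (\<Sum>n\<in>{1..m}. cofactor {n} \<bullet> wedge (grad n) (grad j))"
    by (simp add: grad_fprod wedge_sum wedge_linear)
  also have "\<dots> = (\<Sum>n\<in>{1..m} - {j}. cofactor {n} \<bullet> wedge (grad n) (grad j))"
    using assms by (simp add: sum.remove[of _ j] wedge_linear(3) tsmult_simps)
  also have "\<dots> = (\<Sum>n\<in>{1..m} - {j}. f j \<bullet> cofactor {n, j} \<bullet> wedge (grad n) (grad j))"
    using assms by (intro sum.cong refl)
      (auto simp: cofactor_insert[of j "{_}"] tsmult_simps(3) insert_commute)
  finally show ?thesis by (simp add: omega_eq tsmult_sum)
qed

text \<open>The sum is a double sum over an expression that changes sign when \<open>n\<close> and \<open>j\<close> are exchanged.\<close>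

lemma sum_omega: "(\<Sum>j\<in>{1..m}. omega m f j) = 0"
proof -
  let ?w = "\<lambda>n j. cofactor {n, j} \<bullet> wedge (grad n) (grad j)"
  have "(\<Sum>j\<in>{1..m}. omega m f j) = (\<Sum>j\<in>{1..m}. \<Sum>n\<in>{1..m}. ?w n j)"
    unfolding omega_eq
    by (intro sum.cong refl sum.mono_neutral_left) (auto simp: wedge_linear(3) tsmult_simps)
  also have "\<dots> = (\<Sum>j\<in>{1..m}. \<Sum>n\<in>{1..m}. ?w j n)"
    by (rule sum.swap)
  also have "\<dots> = - (\<Sum>j\<in>{1..m}. \<Sum>n\<in>{1..m}. ?w n j)"
    unfolding sum_negf[symmetric]
    by (intro sum.cong refl) (subst wedge_swap, simp add: tsmult_simps insert_commute)
  finally have "(\<Sum>j\<in>{1..m}. omega m f j) = - (\<Sum>j\<in>{1..m}. omega m f j)"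
    using \<open>_ = (\<Sum>j\<in>{1..m}. \<Sum>n\<in>{1..m}. ?w n j)\<close> by simp
  then have "(1 + 1) \<bullet> (\<Sum>j\<in>{1..m}. omega m f j) = 0"
    unfolding tsmult_simps by (metis add.right_inverse)
  then have "2 \<bullet> (\<Sum>j\<in>{1..m}. omega m f j) = 2 \<bullet> 0"
    by (simp only: one_add_one tsmult_simps)
  then show ?thesis by (rule tsmult_cancel[rotated]) simp
qed

text \<open>\<open>f\<^sub>j \<omega>\<^sub>j = dF \<and> df\<^sub>j\<close> is linear in \<open>df\<^sub>j\<close>, and \<open>dx\<close>, \<open>dy\<close>, \<open>dz\<close> are the differentials of the first
  three components.\<close>

lemma omega_relation:
  assumes "j \<in> {1..m}"
  shows "f j \<bullet> omega m f j = (var_x * d_x (f j)) \<bullet> omega m f 1 + (var_y * d_y (f j)) \<bullet> omega m f 2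
    + (var_z * d_z (f j)) \<bullet> omega m f 3"
proof -
  have "f j \<bullet> omega m f j = wedge (ext_d fprod) (grad j)" using assms by (rule omega_scaled)
  also have "\<dots> = d_x (f j) \<bullet> wedge (ext_d fprod) (grad 1) + d_y (f j) \<bullet> wedge (ext_d fprod) (grad 2)
      + d_z (f j) \<bullet> wedge (ext_d fprod) (grad 3)"
    by (cases "ext_d fprod")
      (simp add: grad_123 ext_d_def[of "f j"] algebra_simps del: One_nat_def)
  also have "\<dots> = d_x (f j) \<bullet> f 1 \<bullet> omega m f 1 + d_y (f j) \<bullet> f 2 \<bullet> omega m f 2
      + d_z (f j) \<bullet> f 3 \<bullet> omega m f 3"
    using m by (simp add: omega_scaled)
  finally show ?thesis
    by (simp add: f123 mult.commute del: One_nat_def flip: tsmult_simps(3))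
qed

lemma dot_omega_grad:
  assumes "j \<in> {1..m}" "k \<in> {1..m}"
  shows "dot (grad k) (omega m f j) = f k * minor j k"
proof -
  have "f j * dot (grad k) (omega m f j) = dot (grad k) (f j \<bullet> omega m f j)" by (simp add: dot_linear)
  also have "\<dots> = det3 (grad k) (ext_d fprod) (grad j)"
    by (simp only: omega_scaled[OF assms(1)] dot_wedge)
  also have "\<dots> = det3 (ext_d fprod) (grad j) (grad k)" by (rule det3_rotate)
  also have "\<dots> = f j * (f k * minor j k)"
    using det_grad_fprod[OF assms] by (cases "j = k") (simp_all add: minor_def mult.assoc)
  finally show ?thesis using f_nz[OF assms(1)] by simp
qed

lemma dot_grad_fprod_omega:
  assumes "j \<in> {1..m}"
  shows "dot (omega m f j) (ext_d fprod) = 0"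
proof -
  have "f j * dot (omega m f j) (ext_d fprod) = dot (wedge (ext_d fprod) (grad j)) (ext_d fprod)"
    by (simp add: dot_linear flip: omega_scaled[OF assms])
  also have "\<dots> = 0"
    by (cases "ext_d fprod"; cases "grad j") (simp add: dot_def algebra_simps)
  finally show ?thesis using f_nz[OF assms(1)] by simp
qed

text \<open>The syzygies have rank two, so three of them satisfy a Cramer relation. It is the double vector
  product of \<open>dF\<close>, \<open>\<theta>\<close>, \<open>df\<^sub>i\<close>, \<open>df\<^sub>j\<close>, divided by \<open>f\<^sub>i f\<^sub>j\<close>.\<close>

lemma minor_mult_syzygy:
  assumes "dot \<theta> (ext_d fprod) = 0" "i \<in> {1..m}" "j \<in> {1..m}" "i \<noteq> j"
    and "dot \<theta> (grad i) = f i * g i" "dot \<theta> (grad j) = f j * g j"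
  shows "minor i j \<bullet> \<theta> = g j \<bullet> omega m f i - g i \<bullet> omega m f j"
proof (rule tsmult_cancel)
  show "f i * f j \<noteq> 0" using f_nz assms by simp
  have "(f i * f j) \<bullet> minor i j \<bullet> \<theta> = det3 (ext_d fprod) (grad i) (grad j) \<bullet> \<theta>"
    by (simp only: det_grad_fprod[OF assms(2-4)] tsmult_simps(3))
  also have "\<dots> = (f j * g j) \<bullet> f i \<bullet> omega m f i - (f i * g i) \<bullet> f j \<bullet> omega m f j"
    by (simp add: double_wedge omega_scaled[OF assms(2)] omega_scaled[OF assms(3)] assms(1,5,6)
        tsmult_simps(8))
  also have "\<dots> = (f i * f j) \<bullet> (g j \<bullet> omega m f i - g i \<bullet> omega m f j)"
    by (simp add: tsmult_simps(5) ac_simps flip: tsmult_simps(3))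
  finally show "(f i * f j) \<bullet> minor i j \<bullet> \<theta> = (f i * f j) \<bullet> (g j \<bullet> omega m f i - g i \<bullet> omega m f j)" .
qed

lemma minor_swap: "minor i j = - minor j i"
  unfolding minor_def sum_negf[symmetric]
  by (subst det3_swap) (simp add: insert_commute)

lemma minor_expand:
  assumes "n \<in> {1..m}" "n \<notin> {k, l}"
  shows "minor k l = cofactor {n, k, l} * det3 (grad n) (grad k) (grad l)
    + f n * (\<Sum>t\<in>{1..m} - {n, k, l}. cofactor {t, n, k, l} * det3 (grad t) (grad k) (grad l))"
proof -
  let ?g = "\<lambda>t. if t = n then 0 else det3 (grad t) (grad k) (grad l)"
  have "minor k l = cofactor {n, k, l} * det3 (grad n) (grad k) (grad l)
      + (\<Sum>t\<in>{1..m} - {k, l} - {n}. cofactor {t, k, l} * det3 (grad t) (grad k) (grad l))"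
    unfolding minor_def by (rule sum.remove) (use assms in auto)
  also have "(\<Sum>t\<in>{1..m} - {k, l} - {n}. cofactor {t, k, l} * det3 (grad t) (grad k) (grad l))
      = (\<Sum>t\<in>{1..m} - {k, l}. cofactor {t, k, l} * ?g t)"
    by (rule sum.mono_neutral_cong_left) (use assms in auto)
  also have "\<dots> = f n * (\<Sum>t\<in>{1..m} - {n, k, l}. cofactor {t, n, k, l} * ?g t)"
    using assms by (intro cofactor_sum_factor) auto
  also have "(\<Sum>t\<in>{1..m} - {n, k, l}. cofactor {t, n, k, l} * ?g t)
      = (\<Sum>t\<in>{1..m} - {n, k, l}. cofactor {t, n, k, l} * det3 (grad t) (grad k) (grad l))"
    by (intro sum.cong) auto
  finally show ?thesis .
qed

text \<open>As \<open>\<omega>\<^sub>n\<close>, \<open>\<omega>\<^sub>k\<close>, \<open>\<omega>\<^sub>l\<close> lie in a module of rank two, they satisfy a relation whose coefficients are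
  the minors. The lemma writes this relation as a combination of \<open>(1, \<dots>, 1)\<close>, with coefficient \<open>\<sigma>\<close>,
  and of the \<open>\<rho>\<^sub>j\<close>, with coefficients \<open>w\<^sub>j\<close>. Since \<open>\<Sum> w\<^sub>j df\<^sub>j = 0\<close>, the entries of the \<open>\<rho>\<^sub>j\<close> with the
  partial derivatives of \<open>f\<^sub>j\<close> add up to zero, and only \<open>\<sigma> + f\<^sub>i w\<^sub>i\<close> remains in coordinate \<open>i\<close>.\<close>

lemma pluecker_relation:
  assumes "n \<in> {1..m}" "k \<in> {1..m}" "l \<in> {1..m}" "k \<noteq> l"
  shows "\<exists>\<sigma> w. (\<Sum>j\<in>{1..m}. w j \<bullet> grad j) = 0 \<and>
    (\<forall>i\<in>{1..m}. (if i = n then minor k l else 0) + (if i = k then minor l n else 0)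
      + (if i = l then minor n k else 0) = \<sigma> + f i * w i)"
proof (cases "n = k \<or> n = l")
  case True
  then have "(if i = n then minor k l else 0) + (if i = k then minor l n else 0)
      + (if i = l then minor n k else 0) = 0 + f i * 0" for i
    using assms(4) minor_swap[of k l] by (auto simp: minor_def)
  then show ?thesis by (intro exI[of _ 0] exI[of _ "\<lambda>_. 0"]) (simp add: tsmult_simps)
next
  case False
  define c where "c t = cofactor {t, n, k, l}" for t
  define D where "D i j k = det3 (grad i) (grad j) (grad k)" for i j k
  let ?T = "{1..m} - {n, k, l}"
  \<comment> \<open>The coordinates outside \<open>{n, k, l}\<close> determine \<open>w t\<close> from \<open>\<sigma>\<close>; the other three values of \<open>w\<close> are what
    is left of the minors after the summand \<open>\<sigma>\<close> is removed, and \<open>\<Sum> w\<^sub>j df\<^sub>j = 0\<close> is Cramer's rule.\<close>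
  define \<sigma> where "\<sigma> = cofactor {n, k, l} * D n k l"
  define w where "w j = (if j = n then \<Sum>t\<in>?T. c t * D t k l else if j = k then \<Sum>t\<in>?T. c t * D t l n
      else if j = l then \<Sum>t\<in>?T. c t * D t n k else - (c j * D n k l))" for j
  have w: "w n = (\<Sum>t\<in>?T. c t * D t k l)" "w k = (\<Sum>t\<in>?T. c t * D t l n)" "w l = (\<Sum>t\<in>?T. c t * D t n k)"
    "\<And>t. t \<in> ?T \<Longrightarrow> w t = - (c t * D n k l)"
    using False assms(4) by (auto simp: w_def)
  have "{1..m} = insert n (insert k (insert l ?T))" using assms by auto
  then have "(\<Sum>j\<in>{1..m}. w j \<bullet> grad j) = (\<Sum>j\<in>insert n (insert k (insert l ?T)). w j \<bullet> grad j)"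
    by simp
  also have "\<dots> = w n \<bullet> grad n + w k \<bullet> grad k + w l \<bullet> grad l + (\<Sum>t\<in>?T. w t \<bullet> grad t)"
    using False assms(4) by (simp add: add.assoc)
  also have "\<dots> = (\<Sum>t\<in>?T. c t \<bullet> (D t k l \<bullet> grad n + D t l n \<bullet> grad k + D t n k \<bullet> grad l - D n k l \<bullet> grad t))"
    by (simp add: w sum_tsmult tsmult_simps sum.distrib sum_negf sum_subtractf)
  also have "\<dots> = 0" by (simp add: D_def det3_cramer tsmult_simps)
  finally have "(\<Sum>j\<in>{1..m}. w j \<bullet> grad j) = 0" .
  moreover have "minor k l = \<sigma> + f n * w n"
    using minor_expand[of n k l] False assms by (simp add: \<sigma>_def w c_def D_def)
  moreover have "minor l n = \<sigma> + f k * w k"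
    using minor_expand[of k l n] False assms
    by (simp add: \<sigma>_def w c_def D_def insert_commute det3_rotate[of "grad k" "grad l" "grad n"] det3_rotate[of "grad l" "grad n" "grad k"])
  moreover have "minor n k = \<sigma> + f l * w l"
    using minor_expand[of l n k] False assms
    by (simp add: \<sigma>_def w c_def D_def insert_commute det3_rotate[of "grad l" "grad n" "grad k"])
  moreover have "0 = \<sigma> + f i * w i" if "i \<in> ?T" for i
    using that cofactor_insert[of i "{n, k, l}"] by (simp add: w(4) \<sigma>_def c_def)
  ultimately show ?thesis using False assms(4)
    by (intro exI[of _ \<sigma>] exI[of _ w]) auto
qed

text \<open>Pairing a relation \<open>v\<close> with \<open>df\<^sub>j\<close> shows that \<open>v\<close> is orthogonal to every column of minors. Hence
  \<open>minor k l\<close> times \<open>v\<close> is the combination, with coefficients \<open>v\<^sub>n\<close>, of the relations in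
  \<open>pluecker_relation\<close>.\<close>

lemma minor_mult_relation:
  assumes v: "(\<Sum>i\<in>{1..m}. v i \<bullet> omega m f i) = 0" and kl: "k \<in> {1..m}" "l \<in> {1..m}" "k \<noteq> l"
  obtains \<sigma> w where "(\<Sum>j\<in>{1..m}. w j \<bullet> grad j) = 0"
    and "\<And>i. i \<in> {1..m} \<Longrightarrow> minor k l * v i = \<sigma> + f i * w i"
proof -
  have *: "(\<Sum>n\<in>{1..m}. v n * minor n j) = 0" if j: "j \<in> {1..m}" for j
  proof -
    have "f j * (\<Sum>n\<in>{1..m}. v n * minor n j) = dot (grad j) (\<Sum>i\<in>{1..m}. v i \<bullet> omega m f i)"
      using j by (simp add: dot_sum dot_linear dot_omega_grad sum_distrib_left ac_simps)
    also have "\<dots> = 0" using v by (simp add: dot_linear)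
    finally show ?thesis using f_nz[OF j] by simp
  qed
  define Q where "Q n \<sigma> w \<longleftrightarrow> (\<Sum>j\<in>{1..m}. w j \<bullet> grad j) = 0 \<and>
    (\<forall>i\<in>{1..m}. (if i = n then minor k l else 0) + (if i = k then minor l n else 0)
      + (if i = l then minor n k else 0) = \<sigma> + f i * w i)" for n \<sigma> w
  have "\<forall>n\<in>{1..m}. \<exists>\<sigma> w. Q n \<sigma> w" using pluecker_relation[OF _ kl] by (simp add: Q_def)
  then obtain s u where "\<And>n. n \<in> {1..m} \<Longrightarrow> Q n (s n) (u n)" by metis
  then have su: "\<And>n. n \<in> {1..m} \<Longrightarrow> (\<Sum>j\<in>{1..m}. u n j \<bullet> grad j) = 0"
    "\<And>n i. n \<in> {1..m} \<Longrightarrow> i \<in> {1..m} \<Longrightarrow> (if i = n then minor k l else 0)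
      + (if i = k then minor l n else 0) + (if i = l then minor n k else 0) = s n + f i * u n i"
    unfolding Q_def by blast+
  show ?thesis
  proof
    have "(\<Sum>j\<in>{1..m}. (\<Sum>n\<in>{1..m}. v n * u n j) \<bullet> grad j)
        = (\<Sum>n\<in>{1..m}. v n \<bullet> (\<Sum>j\<in>{1..m}. u n j \<bullet> grad j))"
      by (simp add: sum_tsmult tsmult_sum tsmult_simps(3)) (rule sum.swap)
    then show "(\<Sum>j\<in>{1..m}. (\<Sum>n\<in>{1..m}. v n * u n j) \<bullet> grad j) = 0"
      using su(1) by (simp add: tsmult_simps)
    fix i assume i: "i \<in> {1..m}"
    have "(\<Sum>n\<in>{1..m}. v n * s n) + f i * (\<Sum>n\<in>{1..m}. v n * u n i) = (\<Sum>n\<in>{1..m}. v n * (s n + f i * u n i))"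
      by (simp add: sum_distrib_left sum.distrib algebra_simps)
    also have "\<dots> = (\<Sum>n\<in>{1..m}. v n * ((if i = n then minor k l else 0)
        + (if i = k then minor l n else 0) + (if i = l then minor n k else 0)))"
      using su(2) i by (intro sum.cong) auto
    also have "\<dots> = (\<Sum>n\<in>{1..m}. (if i = n then v n * minor k l else 0)
        + (if i = k then - (v n * minor n l) else 0) + (if i = l then v n * minor n k else 0))"
    proof (rule sum.cong[OF refl])
      fix n
      have "minor l n = - minor n l" by (rule minor_swap)
      then show "v n * ((if i = n then minor k l else 0) + (if i = k then minor l n else 0)
            + (if i = l then minor n k else 0))
          = (if i = n then v n * minor k l else 0) + (if i = k then - (v n * minor n l) else 0)
            + (if i = l then v n * minor n k else 0)"
        by (simp only: distrib_left if_distrib[of "\<lambda>c. v n * c"] mult_zero_right mult_minus_right)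
    qed
    also have "\<dots> = v i * minor k l + (if i = k then - (\<Sum>n\<in>{1..m}. v n * minor n l) else 0)
        + (if i = l then \<Sum>n\<in>{1..m}. v n * minor n k else 0)"
      using i by (simp add: sum.distrib sum_negf)
    also have "\<dots> = minor k l * v i" using *[OF kl(1)] *[OF kl(2)] by (simp add: mult.commute)
    finally show "minor k l * v i = (\<Sum>n\<in>{1..m}. v n * s n) + f i * (\<Sum>n\<in>{1..m}. v n * u n i)" ..
  qed
qed

end

section \<open>Homology killed by a regular sequence\<close>

text \<open>The powers of the three variables form a regular sequence; this is the part of that fact that
  is used for exactness at the syzygy module. In a polynomial ring over \<open>\<complex>[x, y]\<close> it is read off from
  the coefficients of \<open>z\<^sup>k\<^sup>+\<^sup>N\<close>.\<close>

lemma power_var_relation: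
  assumes "var_z ^ N * p + var_x ^ N * q + var_y ^ N * r = 0"
  shows "\<exists>g h. p = var_x ^ N * g + var_y ^ N * h"
proof -
  have const: "coeff ([:a:] ^ N * u) k = a ^ N * coeff u k" for a :: "complex poly poly" and u :: mpoly and k
    by (induction N) (simp_all add: mult.assoc)
  have "coeff p k + (coeff (var_x ^ N * q) (k + N) + coeff (var_y ^ N * r) (k + N)) = 0" for k
  proof -
    have "var_z ^ N = monom 1 N" unfolding var_z_def by (metis monom_altdef smult_1_left)
    then have "coeff (var_z ^ N * p) (k + N) = coeff p k" by (simp add: coeff_monom_mult)
    then show ?thesis using arg_cong[OF assms, of "\<lambda>u. coeff u (k + N)"] by (simp add: add.assoc)
  qed
  note coeffs = this
  have "p = var_x ^ N * (- poly_shift N q) + var_y ^ N * (- poly_shift N r)"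
  proof (rule poly_eqI)
    fix k
    show "coeff p k = coeff (var_x ^ N * (- poly_shift N q) + var_y ^ N * (- poly_shift N r)) k"
      using coeffs[of k] unfolding var_x_def var_y_def
      by (simp only: coeff_add const coeff_minus coeff_poly_shift mult_minus_right
          minus_add_distrib[symmetric] eq_neg_iff_add_eq_0)
  qed
  then show ?thesis by blast
qed

text \<open>The cokernel of an injective map of free modules has no nonzero element that is killed by two
  coprime ring elements: if \<open>s v = \<rho> a\<close> and \<open>t v = \<rho> b\<close>, then \<open>t a = s b\<close> by injectivity, so \<open>s\<close>
  divides \<open>a\<close>.\<close>

lemma mem_image_if_coprime_multiples:
  fixes \<rho> :: "(nat \<Rightarrow> mpoly) \<Rightarrow> nat \<Rightarrow> mpoly"
  assumes add: "\<And>a b. \<rho> (\<lambda>i. a i + b i) = (\<lambda>i. \<rho> a i + \<rho> b i)"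
    and smult: "\<And>p a. \<rho> (\<lambda>i. p * a i) = (\<lambda>i. p * \<rho> a i)"
    and inj: "\<And>a. a \<in> free_carrier J \<Longrightarrow> \<rho> a = (\<lambda>_. 0) \<Longrightarrow> a = (\<lambda>_. 0)"
    and st: "coprime s t" "s \<noteq> 0"
    and v: "(\<lambda>i. s * v i) \<in> \<rho> ` free_carrier J" "(\<lambda>i. t * v i) \<in> \<rho> ` free_carrier J"
  shows "v \<in> \<rho> ` free_carrier J"
proof -
  obtain a b where ab: "a \<in> free_carrier J" "b \<in> free_carrier J"
    "(\<lambda>i. s * v i) = \<rho> a" "(\<lambda>i. t * v i) = \<rho> b"
    using v by blast
  have va: "s * v i = \<rho> a i" and vb: "t * v i = \<rho> b i" for i
    using ab(3,4) by (metis (no_types))+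
  have "\<rho> (\<lambda>i. t * a i + (- s) * b i) = (\<lambda>i. t * \<rho> a i + (- s) * \<rho> b i)"
    by (simp only: add smult)
  also have "\<dots> = (\<lambda>_. 0)" by (simp add: algebra_simps flip: va vb)
  finally have comb: "(\<lambda>i. t * a i + (- s) * b i) = (\<lambda>_. 0)"
    using ab(1,2) by - (rule inj, auto simp: free_carrier_def)
  have eq: "t * a i = s * b i" for i
    using fun_cong[OF comb, of i] by simp
  have "s dvd a i" for i
  proof -
    have "s dvd t * a i" by (simp add: eq)
    then show ?thesis using st(1) by (simp add: coprime_dvd_mult_right_iff)
  qed
  then have "\<forall>i. \<exists>q. a i = s * q" by (auto elim: dvdE)
  from choice[OF this] obtain a' where a': "\<And>i. a i = s * a' i" by blast
  then have "a' \<in> free_carrier J" using ab(1) st(2) by (auto simp: free_carrier_def)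
  moreover have "v = \<rho> a'"
  proof
    fix i
    have "s * v i = \<rho> (\<lambda>i. s * a' i) i" unfolding va by (simp flip: a')
    then show "v i = \<rho> a' i" using st(2) by (simp add: smult)
  qed
  ultimately show ?thesis by blast
qed

text \<open>One step further to the right, three elements are needed. If \<open>s \<theta> = \<omega> a\<close>, \<open>t \<theta> = \<omega> b\<close>, \<open>u \<theta> = \<omega> c\<close>,
  then the differences \<open>t a - s b\<close>, \<open>u b - t c\<close>, \<open>s c - u a\<close> are relations \<open>\<rho> p\<close>, \<open>\<rho> q\<close>, \<open>\<rho> r\<close>, and
  \<open>u p + s q + t r\<close> is mapped to zero. Therefore \<open>p = s G + t H\<close>, so that \<open>a\<close> becomes divisible by \<open>s\<close>
  after \<open>\<rho> H\<close> is subtracted, and the quotient is a preimage of \<open>\<theta>\<close>.\<close>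

lemma mem_image_if_regular_multiples:
  fixes \<rho> :: "(nat \<Rightarrow> mpoly) \<Rightarrow> nat \<Rightarrow> mpoly" and \<omega> :: "(nat \<Rightarrow> mpoly) \<Rightarrow> triple"
  assumes add: "\<And>a b. \<rho> (\<lambda>i. a i + b i) = (\<lambda>i. \<rho> a i + \<rho> b i)"
    and smult: "\<And>p a. \<rho> (\<lambda>i. p * a i) = (\<lambda>i. p * \<rho> a i)"
    and inj: "\<And>a. a \<in> free_carrier J \<Longrightarrow> \<rho> a = (\<lambda>_. 0) \<Longrightarrow> a = (\<lambda>_. 0)"
    and range: "\<And>a. a \<in> free_carrier J \<Longrightarrow> \<rho> a \<in> free_carrier K"
    and add': "\<And>a b. \<omega> (\<lambda>i. a i + b i) = \<omega> a + \<omega> b"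
    and smult': "\<And>p a. \<omega> (\<lambda>i. p * a i) = p \<bullet> \<omega> a"
    and ker: "\<And>a. a \<in> free_carrier K \<Longrightarrow> \<omega> a = 0 \<longleftrightarrow> a \<in> \<rho> ` free_carrier J"
    and st: "coprime s t" "s \<noteq> 0"
    and u: "\<And>p q r. u * p + s * q + t * r = 0 \<Longrightarrow> \<exists>g h. p = s * g + t * h"
    and \<theta>: "s \<bullet> \<theta> \<in> \<omega> ` free_carrier K" "t \<bullet> \<theta> \<in> \<omega> ` free_carrier K" "u \<bullet> \<theta> \<in> \<omega> ` free_carrier K"
  shows "\<theta> \<in> \<omega> ` free_carrier K"
proof -
  obtain a b c where abc: "a \<in> free_carrier K" "b \<in> free_carrier K" "c \<in> free_carrier K"
    and \<omega>: "s \<bullet> \<theta> = \<omega> a" "t \<bullet> \<theta> = \<omega> b" "u \<bullet> \<theta> = \<omega> c"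
    using \<theta> by blast
  have cycle: "\<exists>p\<in>free_carrier J. (\<lambda>i. y * a i + (- x) * b i) = \<rho> p"
    if "a \<in> free_carrier K" "b \<in> free_carrier K" "x \<bullet> \<theta> = \<omega> a" "y \<bullet> \<theta> = \<omega> b" for x y a b
  proof -
    have "(\<lambda>i. y * a i + (- x) * b i) \<in> free_carrier K"
      using that by (auto simp: free_carrier_def)
    moreover have "\<omega> (\<lambda>i. y * a i + (- x) * b i) = 0"
      unfolding add' smult' that(3,4)[symmetric]
      by (simp add: tsmult_simps(6) tsmult_commute[of y])
    ultimately show ?thesis using ker by blast
  qed
  obtain p where p: "p \<in> free_carrier J" "(\<lambda>i. t * a i + (- s) * b i) = \<rho> p"
    using cycle[OF abc(1,2) \<omega>(1,2)] by blast
  obtain q where q: "q \<in> free_carrier J" "(\<lambda>i. u * b i + (- t) * c i) = \<rho> q"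
    using cycle[OF abc(2,3) \<omega>(2,3)] by blast
  obtain r where r: "r \<in> free_carrier J" "(\<lambda>i. s * c i + (- u) * a i) = \<rho> r"
    using cycle[OF abc(3,1) \<omega>(3,1)] by blast
  have "\<rho> (\<lambda>i. u * p i + (s * q i + t * r i)) = (\<lambda>i. u * \<rho> p i + (s * \<rho> q i + t * \<rho> r i))"
    by (simp only: add smult)
  also have "\<dots> = (\<lambda>_. 0)" by (simp add: algebra_simps flip: p(2) q(2) r(2))
  finally have comb: "(\<lambda>i. u * p i + (s * q i + t * r i)) = (\<lambda>_. 0)"
    using p(1) q(1) r(1) by - (rule inj, auto simp: free_carrier_def)
  have "u * p i + s * q i + t * r i = 0" for i
    using fun_cong[OF comb, of i] by (simp only: add.assoc)
  then have "\<exists>g h. p i = s * g + t * h" for i by (rule u)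
  then obtain g h where gh: "\<And>i. p i = s * g i + t * h i" by metis
  define G where "G i = (if i \<in> J then g i else 0)" for i
  define H where "H i = (if i \<in> J then h i else 0)" for i
  have GH: "G \<in> free_carrier J" "H \<in> free_carrier J" by (auto simp: G_def H_def free_carrier_def)
  have "p = (\<lambda>i. s * G i + t * H i)"
    using gh p(1) by (auto simp: G_def H_def free_carrier_def)
  then have "\<rho> p = (\<lambda>i. s * \<rho> G i + t * \<rho> H i)" by (simp only: add smult)
  then have comb: "(\<lambda>i. t * a i + (- s) * b i) = (\<lambda>i. s * \<rho> G i + t * \<rho> H i)"
    using p(2) by simp
  have eq: "t * (a i + (- 1) * \<rho> H i) = s * (b i + \<rho> G i)" for i
    using fun_cong[OF comb, of i] by (simp add: algebra_simps)
  have "s dvd a i + (- 1) * \<rho> H i" for i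
  proof -
    have "s dvd t * (a i + (- 1) * \<rho> H i)" by (simp only: eq dvd_triv_left)
    then show ?thesis using st(1) by (simp only: coprime_dvd_mult_right_iff)
  qed
  then have "\<forall>i. \<exists>q. a i + (- 1) * \<rho> H i = s * q" by (blast elim: dvdE)
  from choice[OF this] obtain a' where a': "\<And>i. a i + (- 1) * \<rho> H i = s * a' i" by blast
  have "a' \<in> free_carrier K"
    unfolding free_carrier_def mem_Collect_eq
  proof (intro allI impI)
    fix i assume "i \<notin> K"
    then have "s * a' i = 0"
      using abc(1) range[OF GH(2)] by (simp add: free_carrier_def flip: a')
    then show "a' i = 0" using st(2) by simp
  qed
  moreover have "\<theta> = \<omega> a'"
  proof (rule tsmult_cancel[OF st(2)])
    have "\<omega> (\<rho> H) = 0" using ker[OF range[OF GH(2)]] GH(2) by blast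
    then have "s \<bullet> \<theta> = \<omega> (\<lambda>i. a i + (- 1) * \<rho> H i)"
      unfolding add' smult' by (simp add: \<omega> tsmult_simps)
    also have "\<dots> = s \<bullet> \<omega> a'" unfolding a' smult' ..
    finally show "s \<bullet> \<theta> = s \<bullet> \<omega> a'" .
  qed
  ultimately show ?thesis by blast
qed

section \<open>Normal crossing arrangements\<close>

lemma omega_map_linear:
  "omega_map m f (\<lambda>i. a i + b i) = omega_map m f a + omega_map m f b"
  "omega_map m f (\<lambda>i. p * a i) = p \<bullet> omega_map m f a"
  by (simp_all add: omega_map_def tsmult_simps sum.distrib tsmult_sum)

lemma rho_map_linear:
  "rho_map m f (\<lambda>i. a i + b i) = (\<lambda>i. rho_map m f a i + rho_map m f b i)"
  "rho_map m f (\<lambda>i. p * a i) = (\<lambda>i. p * rho_map m f a i)"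
  by (simp_all add: rho_map_def algebra_simps sum.distrib sum_distrib_left)

locale nc_arrangement = arrangement +
  fixes e :: "nat \<Rightarrow> nat"
  assumes hom: "\<And>j. j \<in> {1..m} \<Longrightarrow> homogeneous (int (e j)) (f j)"
    and irr: "\<And>j. j \<in> {1..m} \<Longrightarrow> Factorial_Ring.irreducible (f j)"
    and not_dvd: "\<And>i j. i \<in> {1..m} \<Longrightarrow> j \<in> {1..m} \<Longrightarrow> i \<noteq> j \<Longrightarrow> \<not> f i dvd f j"
    and nc: "normal_crossing {1..m} f"
begin

lemma degree_pos: "j \<in> {1..m} \<Longrightarrow> e j > 0"
proof (rule ccontr)
  assume j: "j \<in> {1..m}" "\<not> e j > 0"
  then obtain c where c: "f j = const c" using homogeneous_degree_0[of "f j"] hom[OF j(1)] by auto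
  then have "c \<noteq> 0" using f_nz[OF j(1)] by auto
  then have "f j dvd 1" unfolding c by (rule const_dvd_1)
  then show False using irr[OF j(1)] by (simp add: irreducible_not_unit)
qed

lemma prime_f: "j \<in> {1..m} \<Longrightarrow> prime_elem (f j)"
  using irr by (intro irreducible_imp_prime_elem_gcd)

lemma coprime_f: "i \<in> {1..m} \<Longrightarrow> j \<in> {1..m} \<Longrightarrow> i \<noteq> j \<Longrightarrow> coprime (f i) (f j)"
  using prime_f not_dvd by (intro prime_elem_imp_coprime)

definition d :: int where "d = (\<Sum>j\<in>{1..m}. int (e j))"

lemma homogeneous_cofactor:
  assumes "T \<subseteq> {1..m}"
  shows "homogeneous (d - (\<Sum>j\<in>T. int (e j))) (cofactor T)"
proof -
  have "d - (\<Sum>j\<in>T. int (e j)) = (\<Sum>j\<in>{1..m} - T. int (e j))"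
    unfolding d_def using assms by (simp add: sum_diff)
  then show ?thesis unfolding cofactor_def using hom by (auto intro: homogeneous_prod)
qed

lemma homogeneous_minor:
  assumes "k \<in> {1..m}" "l \<in> {1..m}" "k \<noteq> l"
  shows "homogeneous (d - 3) (minor k l)"
  unfolding minor_def
proof (rule homogeneous_sum)
  fix n assume n: "n \<in> {1..m} - {k, l}"
  note D = homogeneous_derivatives[OF hom]
  have "homogeneous ((int (e n) - 1) + ((int (e k) - 1) + (int (e l) - 1)))
      (det3 (grad n) (grad k) (grad l))"
    unfolding ext_d_def det3_simp using n assms
    by (intro homogeneous_add homogeneous_diff homogeneous_mult D) auto
  then have "homogeneous ((d - (\<Sum>j\<in>{n, k, l}. int (e j)))
      + ((int (e n) - 1) + ((int (e k) - 1) + (int (e l) - 1))))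
      (cofactor {n, k, l} * det3 (grad n) (grad k) (grad l))"
    using n assms by (intro homogeneous_mult homogeneous_cofactor) auto
  also have "(d - (\<Sum>j\<in>{n, k, l}. int (e j))) + ((int (e n) - 1) + ((int (e k) - 1) + (int (e l) - 1)))
      = d - 3"
    using n assms by auto
  finally show "homogeneous (d - 3) (cofactor {n, k, l} * det3 (grad n) (grad k) (grad l))" .
qed

text \<open>This is where the normal crossing condition enters. By Euler's formula the gradient at \<open>Q\<close> of a
  component through \<open>Q\<close> is orthogonal to \<open>Q\<close>. If no component passes through \<open>Q\<close>, the vanishing of the
  minors for the three lines says that all partial derivatives of the product vanish, and so would
  the product. Otherwise at most two components pass through \<open>Q\<close>, and suitable minors reduce to one determinant
  times a number that is not zero. For a single
  component, the determinants with two coordinate directions give back its gradient. For two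
  components, some coordinate line misses \<open>Q\<close>, and its determinant with the two gradients vanishes
  only if they are dependent.\<close>

lemma minors_no_common_zero:
  assumes Q: "Q \<noteq> (0, 0, 0)"
  shows "\<exists>k\<in>{1..m}. \<exists>l\<in>{1..m}. k \<noteq> l \<and> meval (minor k l) Q \<noteq> 0"
proof (rule ccontr)
  assume "\<not> ?thesis"
  then have zero: "meval (minor k l) Q = 0" if "k \<in> {1..m}" "l \<in> {1..m}" "k \<noteq> l" for k l
    using that by blast
  obtain x y z where xyz: "Q = (x, y, z)" by (metis prod_cases3)
  define \<alpha> where "\<alpha> j = meval (f j) Q" for j
  define a where "a j = meval (d_x (f j)) Q" for j
  define b where "b j = meval (d_y (f j)) Q" for j
  define c where "c j = meval (d_z (f j)) Q" for j
  define D where "D n k l = a n * (b k * c l - c k * b l) - b n * (a k * c l - c k * a l)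
    + c n * (a k * b l - b k * a l)" for n k l
  define J where "J = {j \<in> {1..m}. \<alpha> j = 0}"
  have "finite J" by (simp add: J_def)
  have unit: "a 1 = 1" "b 1 = 0" "c 1 = 0" "a 2 = 0" "b 2 = 1" "c 2 = 0" "a 3 = 0" "b 3 = 0" "c 3 = 1"
    "\<alpha> 1 = x" "\<alpha> 2 = y" "\<alpha> 3 = z"
    unfolding a_def b_def c_def \<alpha>_def f123 derivatives_var xyz by simp_all
  have euler: "x * a j + y * b j + z * c j = of_nat (e j) * \<alpha> j" if "j \<in> {1..m}" for j
    using arg_cong[OF euler_formula[OF hom[OF that]], of "\<lambda>p. meval p Q"]
    by (simp add: a_def b_def c_def \<alpha>_def xyz)
  have orth: "x * a j + y * b j + z * c j = 0" if "j \<in> J" for j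
    using euler[of j] that by (simp add: J_def)
  \<comment> \<open>The normal crossing condition for coefficients supported on at most three components.\<close>
  have indep: "(if j = k then g else 0) + (if j = l then h else 0) + (if j = n then i else 0) = 0"
    if "k \<in> J" "l \<in> J" "n \<in> J" "g * a k + h * a l + i * a n = 0"
      "g * b k + h * b l + i * b n = 0" "g * c k + h * c l + i * c n = 0" "j \<in> J" for g h i j k l n
  proof -
    define w where "w j = (if j = k then g else 0) + (if j = l then h else 0) + (if j = n then i else 0)" for j
    have "(\<Sum>j\<in>J. w j * u j) = g * u k + h * u l + i * u n" for u
      using that(1-3) \<open>finite J\<close>
      by (simp add: w_def distrib_right sum.distrib if_distrib[of "\<lambda>x. x * _"] cong: if_cong)
    with that(4-6) have "(\<Sum>j\<in>J. w j * a j) = 0 \<and> (\<Sum>j\<in>J. w j * b j) = 0 \<and> (\<Sum>j\<in>J. w j * c j) = 0"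
      by simp
    then have "\<forall>j\<in>J. w j = 0"
      using nc Q unfolding normal_crossing_def a_def b_def c_def J_def \<alpha>_def Let_def by blast
    then show ?thesis using that(7) by (simp add: w_def)
  qed
  have nonzero: "\<not> (a k = 0 \<and> b k = 0 \<and> c k = 0)" if "k \<in> J" for k
    using indep[of k k k 1 0 0 k] that by auto
  \<comment> \<open>If only the components \<open>n\<close>, \<open>k\<close>, \<open>l\<close> can pass through \<open>Q\<close>, and \<open>n\<close> does, one summand of the minor remains.\<close>
  have single: "D n k l = 0"
    if "k \<in> {1..m}" "l \<in> {1..m}" "k \<noteq> l" "n \<in> J" "n \<noteq> k" "n \<noteq> l" "J \<subseteq> {n, k, l}" for n k l
  proof -
    have "0 = (\<Sum>j\<in>{1..m} - {k, l}. (\<Prod>i\<in>{1..m} - {j, k, l}. \<alpha> i) * D j k l)"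
      using zero[OF that(1-3)]
      by (simp add: minor_def meval_sum meval_prod cofactor_def det3_simp ext_d_def \<alpha>_def a_def b_def c_def D_def)
    also have "\<dots> = (\<Prod>i\<in>{1..m} - {n, k, l}. \<alpha> i) * D n k l
        + (\<Sum>j\<in>{1..m} - {k, l} - {n}. (\<Prod>i\<in>{1..m} - {j, k, l}. \<alpha> i) * D j k l)"
      by (rule sum.remove) (use that in \<open>auto simp: J_def\<close>)
    also have "(\<Sum>j\<in>{1..m} - {k, l} - {n}. (\<Prod>i\<in>{1..m} - {j, k, l}. \<alpha> i) * D j k l) = 0"
    proof (rule sum.neutral, rule ballI)
      fix j assume "j \<in> {1..m} - {k, l} - {n}"
      then have "n \<in> {1..m} - {j, k, l}" "\<alpha> n = 0" using that by (auto simp: J_def)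
      then have "(\<Prod>i\<in>{1..m} - {j, k, l}. \<alpha> i) = 0" by (intro prod_zero) auto
      then show "(\<Prod>i\<in>{1..m} - {j, k, l}. \<alpha> i) * D j k l = 0" by simp
    qed
    finally have "(\<Prod>i\<in>{1..m} - {n, k, l}. \<alpha> i) * D n k l = 0" by simp
    moreover have "(\<Prod>i\<in>{1..m} - {n, k, l}. \<alpha> i) \<noteq> 0" using that(7) by (auto simp: J_def)
    ultimately show ?thesis by simp
  qed
  have "1 \<in> {1..m}" "2 \<in> {1..m}" "3 \<in> {1..m}" using m by auto
  note I123 = this
  show False
  proof (cases "J = {}")
    case True
    have fprod: "d_x fprod = f 2 * f 3 * minor 2 3" "d_y fprod = f 3 * f 1 * minor 3 1"
      "d_z fprod = f 1 * f 2 * minor 1 2"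
      using det_grad_fprod[of 2 3] det_grad_fprod[of 3 1] det_grad_fprod[of 1 2] I123
      unfolding grad_123 ext_d_def[of fprod] det3_simp by simp_all
    have "homogeneous d fprod" using homogeneous_cofactor[of "{}"] by simp
    from arg_cong[OF euler_formula[OF this], of "\<lambda>p. meval p Q"]
    have "of_int d * meval fprod Q = 0"
      using zero[OF I123(2,3)] zero[OF I123(3,1)] zero[OF I123(1,2)] by (simp add: fprod)
    moreover have "d > 0" unfolding d_def
      using degree_pos I123(1) by (intro sum_pos) auto
    moreover have "meval fprod Q \<noteq> 0"
      using True by (auto simp: cofactor_def meval_prod J_def \<alpha>_def)
    ultimately show False by simp
  next
    case False
    then obtain k where k: "k \<in> J" by blast
    show False
    proof (cases "J = {k}")
      case True
      have "D k i j = 0" if "i \<in> {1, 2, 3}" "j \<in> {1, 2, 3}" for i j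
      proof (cases "i = j \<or> k = i \<or> k = j")
        case True
        then show ?thesis by (auto simp: D_def algebra_simps)
      next
        case False
        then show ?thesis using that I123 k \<open>J = {k}\<close> by (intro single) auto
      qed
      then have "D k 2 3 = 0" "D k 3 1 = 0" "D k 1 2 = 0" by auto
      then have "a k = 0" "b k = 0" "c k = 0" unfolding D_def unit by simp_all
      then show False using nonzero[OF k] by simp
    next
      case False
      then obtain l where l: "l \<in> J" "l \<noteq> k" using k by blast
      define U where "U = b k * c l - c k * b l"
      define V where "V = c k * a l - a k * c l"
      define W where "W = a k * b l - b k * a l"
      have cross: "\<not> (U = 0 \<and> V = 0 \<and> W = 0)"
      proof
        assume UVW: "U = 0 \<and> V = 0 \<and> W = 0"
        then have "a k * b l = b k * a l" "c k * a l = a k * c l" "b k * c l = c k * b l"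
          by (auto simp: U_def V_def W_def)
        then have "a k = 0" "b k = 0" "c k = 0"
          using indep[of k l k "a l" "- a k" 0 l] indep[of k l k "b l" "- b k" 0 l]
            indep[of k l k "c l" "- c k" 0 l] k l by (auto simp: algebra_simps)
        then show False using nonzero[OF k] by simp
      qed
      \<comment> \<open>Three gradients orthogonal to \<open>Q\<close> have determinant zero, and then their cross products are the
        coefficients of linear relations between them.\<close>
      have third: "J \<subseteq> {k, l}"
      proof (rule ccontr)
        assume "\<not> J \<subseteq> {k, l}"
        then obtain n where n: "n \<in> J" "n \<noteq> k" "n \<noteq> l" by blast
        let ?E = "\<lambda>j. x * a j + y * b j + z * c j"
        have "x * D n k l = ?E n * (b k * c l - c k * b l) - ?E k * (b n * c l - c n * b l)
            + ?E l * (b n * c k - c n * b k)"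
          "y * D n k l = - ?E n * (a k * c l - c k * a l) + ?E k * (a n * c l - c n * a l)
            - ?E l * (a n * c k - c n * a k)"
          "z * D n k l = ?E n * (a k * b l - b k * a l) - ?E k * (a n * b l - b n * a l)
            + ?E l * (a n * b k - b n * a k)"
          by (simp_all add: D_def algebra_simps)
        then have "x * D n k l = 0" "y * D n k l = 0" "z * D n k l = 0"
          unfolding orth[OF k] orth[OF l(1)] orth[OF n(1)] by simp_all
        then have D: "D n k l = 0" using Q by (auto simp: xyz)
        have "U = 0"
          using indep[of n k l U "b l * c n - c l * b n" "b n * c k - c n * b k" n] n k l(1) D
          unfolding U_def D_def by (simp add: algebra_simps)
        moreover have "V = 0"
          using indep[of n k l V "c l * a n - a l * c n" "c n * a k - a n * c k" n] n k l(1) D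
          unfolding V_def D_def by (simp add: algebra_simps)
        moreover have "W = 0"
          using indep[of n k l W "a l * b n - b l * a n" "a n * b k - b n * a k" n] n k l(1) D
          unfolding W_def D_def by (simp add: algebra_simps)
        ultimately show False using cross by blast
      qed
      \<comment> \<open>Both \<open>Q\<close> and the cross product are orthogonal to the two gradients, so they are parallel.\<close>
      let ?E = "\<lambda>j. x * a j + y * b j + z * c j"
      have "x * V - y * U = c k * ?E l - c l * ?E k" "y * W - z * V = a k * ?E l - a l * ?E k"
        "z * U - x * W = b k * ?E l - b l * ?E k"
        by (simp_all add: U_def V_def W_def algebra_simps)
      then have par: "x * V = y * U" "y * W = z * V" "z * U = x * W"
        unfolding orth[OF k] orth[OF l(1)] by simp_all
      have D: "D k i l = 0" if "i \<in> {1..m}" "\<alpha> i \<noteq> 0" for i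
        using that third k l by (intro single) (auto simp: J_def)
      consider "x \<noteq> 0" | "y \<noteq> 0" | "z \<noteq> 0" using Q by (auto simp: xyz)
      then show False
      proof cases
        case 1
        then have "U = 0" using D[OF I123(1)] unfolding D_def unit U_def by (simp add: algebra_simps)
        then show False using 1 par cross by auto
      next
        case 2
        then have "V = 0" using D[OF I123(2)] unfolding D_def unit V_def by (simp add: algebra_simps)
        then show False using 2 par cross by auto
      next
        case 3
        then have "W = 0" using D[OF I123(3)] unfolding D_def unit W_def by (simp add: algebra_simps)
        then show False using 3 par cross by auto
      qed
    qed
  qed
qed

text \<open>In \<open>\<Sum> (F / f\<^sub>n) \<theta>(f\<^sub>n) = 0\<close> all summands with \<open>n \<noteq> j\<close> are divisible by the prime \<open>f\<^sub>j\<close>, and \<open>F / f\<^sub>j\<close>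
  is not.\<close>

lemma syzygy_log:
  assumes "dot \<theta> (ext_d fprod) = 0" "j \<in> {1..m}"
  shows "f j dvd dot \<theta> (grad j)"
proof -
  have "0 = (\<Sum>n\<in>{1..m}. cofactor {n} * dot \<theta> (grad n))"
    using assms(1) by (simp add: grad_fprod dot_sum dot_linear)
  also have "\<dots> = cofactor {j} * dot \<theta> (grad j) + (\<Sum>n\<in>{1..m} - {j}. cofactor {n} * dot \<theta> (grad n))"
    by (rule sum.remove) (use assms in auto)
  finally have "cofactor {j} * dot \<theta> (grad j) = - (\<Sum>n\<in>{1..m} - {j}. cofactor {n} * dot \<theta> (grad n))"
    by (simp add: eq_neg_iff_add_eq_0)
  moreover have "f j dvd (\<Sum>n\<in>{1..m} - {j}. cofactor {n} * dot \<theta> (grad n))"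
    using assms(2) by (intro dvd_sum dvd_mult2) (auto simp: cofactor_insert[of j])
  ultimately have "f j dvd cofactor {j} * dot \<theta> (grad j)" by simp
  moreover have "coprime (f j) (cofactor {j})"
    unfolding cofactor_def using assms(2) coprime_f by (intro prod_coprime_right) auto
  ultimately show ?thesis by (simp add: coprime_dvd_mult_right_iff)
qed

lemma omega_m: "omega m f m = - (\<Sum>i\<in>{1..m-1}. omega m f i)"
proof -
  have "{1..m} = insert m {1..m-1}" using m by auto
  then have "(\<Sum>i\<in>insert m {1..m-1}. omega m f i) = 0" using sum_omega by metis
  then show ?thesis using m by (simp add: eq_neg_iff_add_eq_0)
qed

lemma omega_map_unit_vec: "i \<in> {1..m-1} \<Longrightarrow> omega_map m f (unit_vec i) = omega m f i"
proof -
  assume i: "i \<in> {1..m-1}"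
  have "omega_map m f (unit_vec i) = (\<Sum>k\<in>{1..m-1}. if k = i then omega m f k else 0)"
    unfolding omega_map_def unit_vec_def by (intro sum.cong) (auto simp: tsmult_simps)
  then show ?thesis using i by simp
qed

lemma omega_in_image:
  assumes "j \<in> {1..m}"
  shows "omega m f j \<in> omega_map m f ` free_carrier {1..m-1}"
proof (cases "j = m")
  case False
  then have j: "j \<in> {1..m-1}" using assms by auto
  then have "unit_vec j \<in> free_carrier {1..m-1}"
    by (auto simp: unit_vec_def free_carrier_def)
  then show ?thesis using omega_map_unit_vec[OF j] by (metis image_eqI)
next
  case True
  define v :: "nat \<Rightarrow> mpoly" where "v i = (if i \<in> {1..m-1} then -1 else 0)" for i
  have "omega m f j = omega_map m f v"
    unfolding omega_map_def sum_negf[symmetric] v_def True omega_m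
    by (intro sum.cong) (auto simp: tsmult_simps)
  moreover have "v \<in> free_carrier {1..m-1}" by (simp add: v_def free_carrier_def)
  ultimately show ?thesis by blast
qed

lemma image_omega_map_combine:
  assumes "s \<in> omega_map m f ` free_carrier K" "t \<in> omega_map m f ` free_carrier K"
  shows "p \<bullet> s + q \<bullet> t \<in> omega_map m f ` free_carrier K"
proof -
  obtain a b where ab: "a \<in> free_carrier K" "b \<in> free_carrier K" "s = omega_map m f a" "t = omega_map m f b"
    using assms by blast
  then have "p \<bullet> s + q \<bullet> t = omega_map m f (\<lambda>i. p * a i + q * b i)" by (simp add: omega_map_linear)
  moreover have "(\<lambda>i. p * a i + q * b i) \<in> free_carrier K" using ab by (auto simp: free_carrier_def)
  ultimately show ?thesis by blast
qed

lemma minor_kills_D0: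
  assumes "dot \<theta> (ext_d fprod) = 0" "k \<in> {1..m}" "l \<in> {1..m}" "k \<noteq> l"
  shows "minor k l \<bullet> \<theta> \<in> omega_map m f ` free_carrier {1..m-1}"
proof -
  obtain g h where "dot \<theta> (grad k) = f k * g" "dot \<theta> (grad l) = f l * h"
    using syzygy_log[OF assms(1)] assms(2,3) by (meson dvdE)
  then have "minor k l \<bullet> \<theta> = h \<bullet> omega m f k + (- g) \<bullet> omega m f l"
    using minor_mult_syzygy[OF assms, of "\<lambda>i. if i = k then g else h"] assms(4)
    by (simp add: tsmult_simps)
  then show ?thesis using image_omega_map_combine omega_in_image assms(2,3) by metis
qed

lemma rho_map_apply:
  "rho_map m f w k = (if k \<in> {4..m-1} then f k * w k else 0) - (if k \<in> {1..m-1} then f m * w m else 0)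
    - ((if k = 1 then var_x * (\<Sum>j\<in>{4..m}. w j * d_x (f j)) else 0)
      + (if k = 2 then var_y * (\<Sum>j\<in>{4..m}. w j * d_y (f j)) else 0)
      + (if k = 3 then var_z * (\<Sum>j\<in>{4..m}. w j * d_z (f j)) else 0))"
proof -
  have eq: "{4..m} = insert m {4..m-1}" using m by auto
  have notin: "m \<notin> {4..m-1}" using m by auto
  have unit: "(\<Sum>i\<in>{1..m-1}. unit_vec i k) = (if k \<in> {1..m-1} then 1 else 0)"
    unfolding unit_vec_def by simp
  have rest: "(\<Sum>j\<in>{4..m-1}. w j * (f j * (if j = m then c else unit_vec j k)))
      = (\<Sum>j\<in>{4..m-1}. if k = j then f j * w j else 0)" for c
    using m by (intro sum.cong) (auto simp: unit_vec_def)
  have "(\<Sum>j\<in>{4..m}. w j * (f j * (if j = m then - (\<Sum>i\<in>{1..m-1}. unit_vec i k) else unit_vec j k)))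
      = - (if k \<in> {1..m-1} then f m * w m else 0) + (\<Sum>j\<in>{4..m-1}. if k = j then f j * w j else 0)"
    unfolding eq unit sum.insert[OF finite_atLeastAtMost notin] rest by simp
  moreover have "(\<Sum>j\<in>{4..m-1}. if k = j then f j * w j else 0) = (if k \<in> {4..m-1} then f k * w k else 0)"
    by simp
  moreover have "(\<Sum>j\<in>{4..m}. w j * (v * p j * unit_vec i k)) = (if k = i then v * (\<Sum>j\<in>{4..m}. w j * p j) else 0)"
    for v p i
    by (simp add: unit_vec_def sum_distrib_left mult.left_commute)
  ultimately show ?thesis
    unfolding rho_map_def rho_def right_diff_distrib distrib_left sum_subtractf sum.distrib
    by simp
qed

lemma rho_map_carrier: "rho_map m f w \<in> free_carrier {1..m-1}"
  unfolding free_carrier_def using m by (auto simp: rho_map_apply)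

end

section \<open>Ideals with three generators\<close>

lemma ideal_S_iff: "ideal I S \<longleftrightarrow> ideal_set (I :: mpoly set)"
proof
  assume "ideal I S"
  then show "ideal_set I"
    using additive_subgroup.a_closed[OF ideal.axioms(1), of I S]
      additive_subgroup.zero_closed[OF ideal.axioms(1), of I S] ideal.I_l_closed[of I S]
    by (auto simp: ideal_set_def ring_of_type_algebra_def)
next
  assume I: "ideal_set I"
  note cl = ideal_set_closed[OF I]
  show "ideal I S"
  proof (rule idealI)
    show "ring S" by (rule ring_from_type_algebra)
    show "subgroup I (add_monoid S)"
    proof (rule group.subgroupI)
      show "group (add_monoid S)"
        using ring_from_type_algebra ring.is_abelian_group abelian_group.a_group by blast
      show "I \<noteq> {}" using cl(1) by auto
      fix a assume a: "a \<in> I"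
      have "inv\<^bsub>add_monoid S\<^esub> a = - a"
        by (rule group.inv_equality[OF \<open>group (add_monoid S)\<close>]) (simp_all add: ring_of_type_algebra_def)
      then show "inv\<^bsub>add_monoid S\<^esub> a \<in> I" using cl(3)[OF a, of "-1"] by simp
    qed (auto simp: ring_of_type_algebra_def cl)
  qed (auto simp: ring_of_type_algebra_def cl)
qed

lemma genideal_3:
  "genideal S {u, v, w} = {a * u + b * v + c * w | a b c. True}" (is "_ = ?I")
proof
  have "u \<in> ?I" by (rule CollectI, rule exI[of _ 1], rule exI[of _ 0], rule exI[of _ 0]) simp
  moreover have "v \<in> ?I" by (rule CollectI, rule exI[of _ 0], rule exI[of _ 1], rule exI[of _ 0]) simp
  moreover have "w \<in> ?I" by (rule CollectI, rule exI[of _ 0], rule exI[of _ 0], rule exI[of _ 1]) simp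
  moreover have "ideal_set ?I"
    unfolding ideal_set_def
  proof (intro conjI ballI allI)
    show "0 \<in> ?I" by (auto intro!: exI[of _ 0])
    show "s + t \<in> ?I" if st: "s \<in> ?I" "t \<in> ?I" for s t
    proof -
      obtain a b c a' b' c' where "s = a * u + b * v + c * w" "t = a' * u + b' * v + c' * w"
        using st by blast
      then have "s + t = (a + a') * u + (b + b') * v + (c + c') * w" by (simp add: algebra_simps)
      then show ?thesis by blast
    qed
    show "r * s \<in> ?I" if s: "s \<in> ?I" for r s
    proof -
      obtain a b c where "s = a * u + b * v + c * w" using s by blast
      then have "r * s = (r * a) * u + (r * b) * v + (r * c) * w" by (simp add: algebra_simps)
      then show ?thesis by blast
    qed
  qed
  ultimately show "genideal S {u, v, w} \<subseteq> ?I"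
    unfolding genideal_def ideal_S_iff by blast
  show "?I \<subseteq> genideal S {u, v, w}"
    unfolding genideal_def ideal_S_iff by (auto intro!: ideal_set_closed(2,3))
qed

lemma mem_max_ideal_if_no_constant_term: "mcoeff p 0 0 0 = 0 \<Longrightarrow> p \<in> max_ideal"
  unfolding max_ideal_def genideal_3
  by (erule no_constant_term_decomposition) (auto simp: mult.commute)

lemma mcoeff_000_mult: "mcoeff (p * q) 0 0 0 = mcoeff p 0 0 0 * mcoeff q 0 0 0"
  by (simp add: mcoeff_mult)

section \<open>Exactness\<close>

definition homogeneous_triple :: "int \<Rightarrow> triple \<Rightarrow> bool" where
  "homogeneous_triple n t \<longleftrightarrow> (case t of (a, b, c) \<Rightarrow> homogeneous n a \<and> homogeneous n b \<and> homogeneous n c)"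

lemma homogeneous_triple_smult:
  "homogeneous a p \<Longrightarrow> homogeneous_triple b t \<Longrightarrow> homogeneous_triple (a + b) (p \<bullet> t)"
  by (cases t) (auto simp: homogeneous_triple_def intro: homogeneous_mult)

lemma homogeneous_triple_add:
  "homogeneous_triple n s \<Longrightarrow> homogeneous_triple n t \<Longrightarrow> homogeneous_triple n (s + t)"
  by (cases s; cases t) (auto simp: homogeneous_triple_def intro: homogeneous_add)

lemma homogeneous_triple_sum:
  "(\<And>a. a \<in> A \<Longrightarrow> homogeneous_triple n (g a)) \<Longrightarrow> homogeneous_triple n (sum g A)"
  by (induction A rule: infinite_finite_induct)
    (auto intro: homogeneous_triple_add, auto simp: homogeneous_triple_def zero_prod_def)

fun triple_vec :: "triple \<Rightarrow> nat \<Rightarrow> mpoly" where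
  "triple_vec (a, b, c) = (\<lambda>k. if k = 1 then a else if k = 2 then b else if k = 3 then c else 0)"

lemma triple_vec_linear:
  "triple_vec (s + t) = (\<lambda>k. triple_vec s k + triple_vec t k)"
  "triple_vec (p \<bullet> t) = (\<lambda>k. p * triple_vec t k)"
  by (cases s; cases t; simp add: fun_eq_iff)+

lemma triple_vec_eq_0: "triple_vec t = (\<lambda>_. 0) \<longleftrightarrow> t = 0"
proof
  assume "triple_vec t = (\<lambda>_. 0)"
  then have "triple_vec t 1 = 0" "triple_vec t 2 = 0" "triple_vec t 3 = 0" by simp_all
  then show "t = 0" by (cases t) (simp add: zero_prod_def)
qed (simp add: zero_prod_def fun_eq_iff)

lemma triple_vec_surj: "v \<in> free_carrier {1..3} \<Longrightarrow> triple_vec (v 1, v 2, v 3) = v"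
  by (auto simp: fun_eq_iff free_carrier_def)

context nc_arrangement
begin

abbreviation "F2 \<equiv> free_carrier {1..m-1}"
abbreviation "F3 \<equiv> free_carrier {4..m}"

lemma rho_relation:
  assumes "j \<in> {4..m}"
  shows "f j \<bullet> (if j = m then - (\<Sum>i\<in>{1..m-1}. omega m f i) else omega m f j)
    - ((var_x * d_x (f j)) \<bullet> omega m f 1 + (var_y * d_y (f j)) \<bullet> omega m f 2
       + (var_z * d_z (f j)) \<bullet> omega m f 3) = 0"
proof -
  have "(if j = m then - (\<Sum>i\<in>{1..m-1}. omega m f i) else omega m f j) = omega m f j"
    using omega_m by simp
  then show ?thesis using omega_relation[of j] assms by simp
qed

lemma omega_map_rho:
  assumes j: "j \<in> {4..m}"
  shows "omega_map m f (rho m f j) = 0"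
proof -
  define u where "u = (\<lambda>k. if j = m then - (\<Sum>i\<in>{1..m-1}. unit_vec i k) else unit_vec j k)"
  have "omega_map m f u = (if j = m then - (\<Sum>i\<in>{1..m-1}. omega m f i) else omega m f j)"
  proof (cases "j = m")
    case True
    have "u k = - 1" if "k \<in> {1..m-1}" for k
      using that True by (simp add: u_def unit_vec_def)
    then have "omega_map m f u = (\<Sum>k\<in>{1..m-1}. - omega m f k)"
      unfolding omega_map_def by (intro sum.cong) (simp_all add: tsmult_simps)
    then show ?thesis using True by (simp add: sum_negf)
  next
    case False
    then have "u = unit_vec j" by (simp add: u_def fun_eq_iff)
    moreover have "j \<in> {1..m-1}" using False j by auto
    ultimately show ?thesis using False by (simp add: omega_map_unit_vec)
  qed
  moreover have "rho m f j = (\<lambda>k. f j * u k + (- 1) * (var_x * d_x (f j) * unit_vec 1 k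
      + (var_y * d_y (f j) * unit_vec 2 k + var_z * d_z (f j) * unit_vec 3 k)))"
    by (simp add: rho_def u_def fun_eq_iff add.assoc)
  ultimately show ?thesis
    using rho_relation[OF j] m omega_map_unit_vec[of 1] omega_map_unit_vec[of 2] omega_map_unit_vec[of 3]
    by (simp only: omega_map_linear) (simp add: tsmult_simps algebra_simps)
qed

lemma omega_map_rho_map: "omega_map m f (rho_map m f w) = 0"
proof -
  have "omega_map m f (rho_map m f w) = (\<Sum>i\<in>{1..m-1}. \<Sum>j\<in>{4..m}. w j \<bullet> rho m f j i \<bullet> omega m f i)"
    by (simp add: omega_map_def rho_map_def sum_tsmult tsmult_simps(3))
  also have "\<dots> = (\<Sum>j\<in>{4..m}. w j \<bullet> omega_map m f (rho m f j))"
    unfolding omega_map_def tsmult_sum by (rule sum.swap)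
  finally show ?thesis by (simp add: omega_map_rho tsmult_simps)
qed

text \<open>Let \<open>\<Sum> w\<^sub>j \<rho>\<^sub>j = 0\<close>. The coordinates from 4 on say that all \<open>f\<^sub>j w\<^sub>j\<close> are equal to one \<open>s\<close>. The sum of
  the first three coordinates is \<open>- 3 s - \<Sum> e\<^sub>j f\<^sub>j w\<^sub>j\<close> by Euler's formula, hence a nonzero multiple
  of \<open>s\<close>.\<close>

lemma rho_map_inj:
  assumes w: "w \<in> F3" and zero: "rho_map m f w = (\<lambda>_. 0)"
  shows "w = (\<lambda>_. 0)"
proof -
  define s where "s = f m * w m"
  have z: "rho_map m f w k = 0" for k using zero by simp
  have fw: "f j * w j = s" if "j \<in> {4..m}" for j
  proof (cases "j = m")
    case False
    then have "j \<in> {4..m-1}" "j \<in> {1..m-1}" "j \<noteq> 1" "j \<noteq> 2" "j \<noteq> 3" using that by auto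
    then show ?thesis using z[of j] unfolding rho_map_apply s_def by simp
  qed (simp add: s_def)
  have 123: "1 \<in> {1..m-1}" "2 \<in> {1..m-1}" "3 \<in> {1..m-1}" using m by auto
  have xyz: "var_x * (\<Sum>j\<in>{4..m}. w j * d_x (f j)) = - s" "var_y * (\<Sum>j\<in>{4..m}. w j * d_y (f j)) = - s"
    "var_z * (\<Sum>j\<in>{4..m}. w j * d_z (f j)) = - s"
    using z[of 1] z[of 2] z[of 3] 123 unfolding rho_map_apply s_def
    by (simp_all add: eq_neg_iff_add_eq_0 add.commute neg_eq_iff_add_eq_0)
  have "- s + - s + - s = var_x * (\<Sum>j\<in>{4..m}. w j * d_x (f j)) + var_y * (\<Sum>j\<in>{4..m}. w j * d_y (f j))
      + var_z * (\<Sum>j\<in>{4..m}. w j * d_z (f j))"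
    by (simp only: xyz)
  also have "\<dots> = (\<Sum>j\<in>{4..m}. w j * (var_x * d_x (f j) + var_y * d_y (f j) + var_z * d_z (f j)))"
    by (simp add: sum_distrib_left sum.distrib algebra_simps)
  also have "\<dots> = (\<Sum>j\<in>{4..m}. const (of_nat (e j)) * s)"
  proof (rule sum.cong[OF refl])
    fix j assume j: "j \<in> {4..m}"
    then have "var_x * d_x (f j) + var_y * d_y (f j) + var_z * d_z (f j) = const (of_nat (e j)) * f j"
      using euler_formula[OF hom[of j]] by simp
    then show "w j * (var_x * d_x (f j) + var_y * d_y (f j) + var_z * d_z (f j)) = const (of_nat (e j)) * s"
      by (simp add: fw[OF j, symmetric] ac_simps)
  qed
  also have "\<dots> = const (of_nat (\<Sum>j\<in>{4..m}. e j)) * s"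
  proof -
    have "const (of_nat (\<Sum>j\<in>A. e j)) = (\<Sum>j\<in>A. const (of_nat (e j)))" for A
      by (induction A rule: infinite_finite_induct) (auto simp: const_add)
    then show ?thesis by (simp add: sum_distrib_right)
  qed
  finally have "- s + - s + - s = const (of_nat (\<Sum>j\<in>{4..m}. e j)) * s" .
  note rel = this
  have "const 3 = 1 + 1 + 1" using const_add[of 1 2] const_add[of 1 1] by simp
  then have "const (3 + of_nat (\<Sum>j\<in>{4..m}. e j)) * s = s + s + s + (- s + - s + - s)"
    unfolding rel by (simp only: const_add distrib_right mult_1_left)
  then have "const (3 + of_nat (\<Sum>j\<in>{4..m}. e j)) * s = 0" by simp
  moreover have "3 + of_nat (\<Sum>j\<in>{4..m}. e j) \<noteq> (0 :: complex)"
    by (metis add_eq_0_iff_both_eq_0 of_nat_add of_nat_eq_0_iff of_nat_numeral zero_neq_numeral)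
  then have "const (3 + of_nat (\<Sum>j\<in>{4..m}. e j)) \<noteq> 0" by (simp add: const_def)
  ultimately have "s = 0" by (metis mult_eq_0_iff)
  show ?thesis
  proof
    fix j show "w j = 0"
    proof (cases "j \<in> {4..m}")
      case True
      then have "f j * w j = 0" "f j \<noteq> 0" using fw \<open>s = 0\<close> f_nz[of j] by auto
      then show ?thesis by simp
    next
      case False
      then show ?thesis using w by (auto simp: free_carrier_def)
    qed
  qed
qed

text \<open>A relation among \<open>\<omega>\<^sub>1, \<dots>, \<omega>\<^sub>m\<^sub>-\<^sub>1\<close> is one among all \<open>\<omega>\<^sub>i\<close> with \<open>v\<^sub>m = 0\<close>; comparing the coordinates \<open>m\<close>
  gives \<open>\<sigma> = - f\<^sub>m w\<^sub>m\<close>. Because of \<open>\<Sum> w\<^sub>j df\<^sub>j = 0\<close>, the values \<open>w\<^sub>1\<close>, \<open>w\<^sub>2\<close>, \<open>w\<^sub>3\<close> are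
  determined by the others, in such a way that the coordinates 1, 2, 3 of the combination of
  \<open>\<rho>\<^sub>4, \<dots>, \<rho>\<^sub>m\<close> are correct.\<close>

lemma minor_kills_relations:
  assumes v: "v \<in> F2" "omega_map m f v = 0" and kl: "k \<in> {1..m}" "l \<in> {1..m}" "k \<noteq> l"
  shows "(\<lambda>i. minor k l * v i) \<in> rho_map m f ` F3"
proof -
  have eq: "{1..m} = insert m {1..m-1}" "m \<notin> {1..m-1}" using m by auto
  have vm: "v m = 0" using v(1) eq(2) unfolding free_carrier_def by blast
  have "(\<Sum>i\<in>{1..m}. v i \<bullet> omega m f i) = v m \<bullet> omega m f m + omega_map m f v"
    unfolding eq(1) omega_map_def by (rule sum.insert) (use eq(2) in auto)
  also have "\<dots> = 0" using v(2) by (simp add: vm tsmult_simps)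
  finally have "(\<Sum>i\<in>{1..m}. v i \<bullet> omega m f i) = 0" .
  from minor_mult_relation[OF this kl] obtain \<sigma> w where w: "(\<Sum>j\<in>{1..m}. w j \<bullet> grad j) = 0"
    and \<sigma>: "\<And>i. i \<in> {1..m} \<Longrightarrow> minor k l * v i = \<sigma> + f i * w i"
    by blast
  define w' where "w' j = (if j \<in> {4..m} then w j else 0)" for j
  have "{1..m} = {1, 2, 3} \<union> {4..m}" using m by auto
  then have split: "(\<Sum>j\<in>{1..m}. w j * p j) = w 1 * p 1 + w 2 * p 2 + w 3 * p 3 + (\<Sum>j\<in>{4..m}. w' j * p j)"
    for p :: "nat \<Rightarrow> mpoly"
    by (simp add: sum.union_disjoint w'_def add.assoc)
  have grads: "(\<Sum>j\<in>{1..m}. w j * d_x (f j)) = 0" "(\<Sum>j\<in>{1..m}. w j * d_y (f j)) = 0"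
    "(\<Sum>j\<in>{1..m}. w j * d_z (f j)) = 0"
    using w by (simp_all add: ext_d_def prod_eq_iff fst_sum snd_sum)
  have "w 1 = - (\<Sum>j\<in>{4..m}. w' j * d_x (f j))" "w 2 = - (\<Sum>j\<in>{4..m}. w' j * d_y (f j))"
    "w 3 = - (\<Sum>j\<in>{4..m}. w' j * d_z (f j))"
    using grads unfolding split f123 derivatives_var by (simp_all add: eq_neg_iff_add_eq_0)
  note w123 = this
  have \<sigma>m: "\<sigma> = - (f m * w' m)" using \<sigma>[of m] m vm by (simp add: w'_def eq_neg_iff_add_eq_0)
  have "minor k l * v i = rho_map m f w' i" for i
  proof (cases "i \<in> {1..m-1}")
    case False
    then show ?thesis using v(1) m by (auto simp: rho_map_apply free_carrier_def)
  next
    case True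
    then have "minor k l * v i = \<sigma> + f i * w i" using \<sigma> by auto
    also have "\<dots> = rho_map m f w' i"
    proof (cases "i \<in> {1, 2, 3}")
      case False
      then have "i \<in> {4..m-1}" using True by auto
      then show ?thesis using False True by (auto simp: rho_map_apply \<sigma>m w'_def)
    next
      case i: True
      then have "i \<notin> {4..m-1}" by auto
      with i True show ?thesis unfolding rho_map_apply \<sigma>m using f123 w123 by (auto simp del: One_nat_def)
    qed
    finally show ?thesis .
  qed
  moreover have "w' \<in> F3" by (simp add: w'_def free_carrier_def)
  ultimately show ?thesis by (metis (no_types, lifting) ext image_eqI)
qed

text \<open>The elements that annihilate the homology form an ideal. It contains the minors, which are
  homogeneous without common zero in \<open>\<P>\<^sup>2\<close>.\<close>

lemma annihilating_powers:
  obtains N where "\<And>s \<theta>. s \<in> {var_x, var_y, var_z} \<Longrightarrow> dot \<theta> (ext_d fprod) = 0 \<Longrightarrow>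
      s ^ N \<bullet> \<theta> \<in> omega_map m f ` F2"
    and "\<And>s v. s \<in> {var_x, var_y, var_z} \<Longrightarrow> v \<in> F2 \<Longrightarrow> omega_map m f v = 0 \<Longrightarrow>
      (\<lambda>i. s ^ N * v i) \<in> rho_map m f ` F3"
proof -
  define I where "I = {u. (\<forall>\<theta>. dot \<theta> (ext_d fprod) = 0 \<longrightarrow> u \<bullet> \<theta> \<in> omega_map m f ` F2) \<and>
     (\<forall>v\<in>F2. omega_map m f v = 0 \<longrightarrow> (\<lambda>i. u * v i) \<in> rho_map m f ` F3)}"
  have rho_comb: "(\<lambda>i. p * s i + q * t i) \<in> rho_map m f ` F3"
    if st: "s \<in> rho_map m f ` F3" "t \<in> rho_map m f ` F3" for s t p q
  proof -
    obtain a b where ab: "a \<in> F3" "b \<in> F3" "s = rho_map m f a" "t = rho_map m f b" using st by blast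
    then have "(\<lambda>i. p * s i + q * t i) = rho_map m f (\<lambda>i. p * a i + q * b i)"
      by (simp only: rho_map_linear)
    moreover have "(\<lambda>i. p * a i + q * b i) \<in> F3" using ab by (auto simp: free_carrier_def)
    ultimately show ?thesis by blast
  qed
  have comb: "p * a + q * b \<in> I" if "a \<in> I" "b \<in> I" for p q a b
    unfolding I_def
  proof (intro CollectI conjI allI impI ballI)
    fix \<theta> assume "dot \<theta> (ext_d fprod) = 0"
    then have "a \<bullet> \<theta> \<in> omega_map m f ` F2" "b \<bullet> \<theta> \<in> omega_map m f ` F2"
      using that unfolding I_def by blast+
    then have "p \<bullet> a \<bullet> \<theta> + q \<bullet> b \<bullet> \<theta> \<in> omega_map m f ` F2"
      by (rule image_omega_map_combine)
    then show "(p * a + q * b) \<bullet> \<theta> \<in> omega_map m f ` F2" by (simp add: tsmult_simps)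
  next
    fix v assume "v \<in> F2" "omega_map m f v = 0"
    then have "(\<lambda>i. p * (a * v i) + q * (b * v i)) \<in> rho_map m f ` F3"
      using that by (intro rho_comb) (auto simp: I_def)
    then show "(\<lambda>i. (p * a + q * b) * v i) \<in> rho_map m f ` F3" by (simp add: algebra_simps)
  qed
  define U where "U = {minor k l | k l. k \<in> {1..m} \<and> l \<in> {1..m} \<and> k \<noteq> l}"
  have "U \<subseteq> I" using minor_kills_D0 minor_kills_relations by (auto simp: U_def I_def)
  moreover have "minor 1 2 \<in> U" using m by (force simp: U_def)
  ultimately have ideal: "ideal_set I"
    unfolding ideal_set_def using comb[of _ _ 0 0] comb[of _ _ 1 1] comb[where q = 0] by auto
  have "\<exists>n. s ^ n \<in> I" if "s \<in> {var_x, var_y, var_z}" for s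
  proof (rule homogeneous_nullstellensatz[OF ideal \<open>U \<subseteq> I\<close> _ _ that])
    show "\<exists>n. homogeneous n u" if "u \<in> U" for u using that homogeneous_minor by (auto simp: U_def)
    show "\<exists>u\<in>U. meval u Q \<noteq> 0" if "Q \<noteq> (0, 0, 0)" for Q
      using minors_no_common_zero[OF that] unfolding U_def by blast
  qed
  then obtain n where n: "\<And>s. s \<in> {var_x, var_y, var_z} \<Longrightarrow> s ^ n s \<in> I" by metis
  define N where "N = n var_x + n var_y + n var_z"
  have "s ^ N \<in> I" if s: "s \<in> {var_x, var_y, var_z}" for s
  proof -
    have "n s \<le> N" using s by (auto simp: N_def)
    then have "s ^ N = s ^ (N - n s) * s ^ n s" by (simp flip: power_add)
    then show ?thesis using ideal_set_closed(3)[OF ideal n[OF s]] by simp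
  qed
  then show ?thesis by (intro that[of N]) (auto simp: I_def simp del: tsmult.simps)
qed

lemma coprime_powers: "coprime (var_x ^ N) (var_y ^ N)"
  using coprime_f[of 1 2] m unfolding f123 by simp

lemma exact_at_F2:
  assumes "v \<in> F2"
  shows "omega_map m f v = 0 \<longleftrightarrow> v \<in> rho_map m f ` F3"
proof
  assume v: "omega_map m f v = 0"
  obtain N where "(\<lambda>i. var_x ^ N * v i) \<in> rho_map m f ` F3" "(\<lambda>i. var_y ^ N * v i) \<in> rho_map m f ` F3"
    using annihilating_powers assms v by (metis insertCI)
  then show "v \<in> rho_map m f ` F3"
    using coprime_powers var_nonzero
    by - (rule mem_image_if_coprime_multiples[OF rho_map_linear rho_map_inj,
          where s = "var_x ^ N" and t = "var_y ^ N"], auto)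
qed (auto simp: omega_map_rho_map)

lemma exact_at_D0: "dot \<theta> (ext_d fprod) = 0 \<longleftrightarrow> \<theta> \<in> omega_map m f ` F2"
proof
  assume \<theta>: "dot \<theta> (ext_d fprod) = 0"
  obtain N where N: "var_x ^ N \<bullet> \<theta> \<in> omega_map m f ` F2" "var_y ^ N \<bullet> \<theta> \<in> omega_map m f ` F2"
    "var_z ^ N \<bullet> \<theta> \<in> omega_map m f ` F2"
    using annihilating_powers \<theta> by (metis insertCI)
  show "\<theta> \<in> omega_map m f ` F2"
    by (rule mem_image_if_regular_multiples[OF rho_map_linear rho_map_inj rho_map_carrier omega_map_linear
          exact_at_F2 coprime_powers _ power_var_relation N]) (use var_nonzero in auto)
next
  assume "\<theta> \<in> omega_map m f ` F2"
  then obtain v where "\<theta> = omega_map m f v" by blast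
  then show "dot \<theta> (ext_d fprod) = 0"
    unfolding omega_map_def dot_sum dot_linear
    by (simp only:) (auto intro!: sum.neutral simp: dot_sum dot_linear dot_grad_fprod_omega)
qed

end

section \<open>The minimal resolutions\<close>

lemma minimal_resolution_of_length_1:
  assumes "finite I0" "finite I1" "graded_hom (graded_free (I0, t0)) M \<epsilon>"
    "graded_hom (graded_free (I1, t1)) (graded_free (I0, t0)) \<phi>"
    "\<epsilon> ` free_carrier I0 = carrier M"
    "{v \<in> free_carrier I0. \<epsilon> v = \<zero>\<^bsub>M\<^esub>} = \<phi> ` free_carrier I1"
    "{v \<in> free_carrier I1. \<phi> v = (\<lambda>_. 0)} = {\<lambda>_. 0}"
    "\<And>v k. v \<in> free_carrier I1 \<Longrightarrow> \<phi> v k \<in> max_ideal"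
  shows "minimal_graded_free_resolution M [(I0, t0), (I1, t1)] \<epsilon> [\<phi>]"
  using assms unfolding minimal_graded_free_resolution_def Let_def
  by (simp add: less_Suc_eq all_conj_distrib)

lemma minimal_resolution_of_length_3:
  assumes "finite I0" "finite I1" "finite I2" "finite I3" "graded_hom (graded_free (I0, t0)) M \<epsilon>"
    "graded_hom (graded_free (I1, t1)) (graded_free (I0, t0)) \<phi>0"
    "graded_hom (graded_free (I2, t2)) (graded_free (I1, t1)) \<phi>1"
    "graded_hom (graded_free (I3, t3)) (graded_free (I2, t2)) \<phi>2"
    "\<epsilon> ` free_carrier I0 = carrier M"
    "{v \<in> free_carrier I0. \<epsilon> v = \<zero>\<^bsub>M\<^esub>} = \<phi>0 ` free_carrier I1"
    "{v \<in> free_carrier I1. \<phi>0 v = (\<lambda>_. 0)} = \<phi>1 ` free_carrier I2"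
    "{v \<in> free_carrier I2. \<phi>1 v = (\<lambda>_. 0)} = \<phi>2 ` free_carrier I3"
    "{v \<in> free_carrier I3. \<phi>2 v = (\<lambda>_. 0)} = {\<lambda>_. 0}"
    "\<And>v k. v \<in> free_carrier I1 \<Longrightarrow> \<phi>0 v k \<in> max_ideal"
    "\<And>v k. v \<in> free_carrier I2 \<Longrightarrow> \<phi>1 v k \<in> max_ideal"
    "\<And>v k. v \<in> free_carrier I3 \<Longrightarrow> \<phi>2 v k \<in> max_ideal"
  shows "minimal_graded_free_resolution M [(I0, t0), (I1, t1), (I2, t2), (I3, t3)] \<epsilon> [\<phi>0, \<phi>1, \<phi>2]"
  using assms unfolding minimal_graded_free_resolution_def Let_def
  by (simp add: less_Suc_eq all_conj_distrib eval_nat_numeral)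

context nc_arrangement
begin

lemma homogeneous_omega:
  assumes "j \<in> {1..m}"
  shows "homogeneous_triple (d - 2) (omega m f j)"
  unfolding omega_eq
proof (rule homogeneous_triple_sum)
  fix n assume n: "n \<in> {1..m} - {j}"
  note D = homogeneous_derivatives[OF hom]
  have "homogeneous_triple ((int (e n) - 1) + (int (e j) - 1)) (wedge (grad n) (grad j))"
    unfolding ext_d_def wedge.simps homogeneous_triple_def prod.case using n assms
    by (intro conjI homogeneous_minus homogeneous_diff homogeneous_mult D) auto
  then have "homogeneous_triple ((d - (\<Sum>i\<in>{n, j}. int (e i))) + ((int (e n) - 1) + (int (e j) - 1)))
      (cofactor {n, j} \<bullet> wedge (grad n) (grad j))"
    using n assms by (intro homogeneous_triple_smult homogeneous_cofactor) auto
  also have "(d - (\<Sum>i\<in>{n, j}. int (e i))) + ((int (e n) - 1) + (int (e j) - 1)) = d - 2"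
    using n by auto
  finally show "homogeneous_triple (d - 2) (cofactor {n, j} \<bullet> wedge (grad n) (grad j))" .
qed

lemma homogeneous_omega_map:
  assumes "\<And>i. i \<in> {1..m-1} \<Longrightarrow> homogeneous a (v i)"
  shows "homogeneous_triple (a + (d - 2)) (omega_map m f v)"
  unfolding omega_map_def using assms
  by (intro homogeneous_triple_sum homogeneous_triple_smult homogeneous_omega) auto

lemma homogeneous_rho:
  assumes "j \<in> {4..m}"
  shows "homogeneous (int (e j)) (rho m f j k)"
proof -
  have j: "homogeneous (int (e j)) (f j)" using hom assms by auto
  have u: "homogeneous 0 (unit_vec i k)" for i by (simp add: unit_vec_def homogeneous_1)
  have "homogeneous (int (e j) + 0) (f j * (if j = m then - (\<Sum>i\<in>{1..m-1}. unit_vec i k) else unit_vec j k))"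
    using u by (intro homogeneous_mult j) (auto intro: homogeneous_minus homogeneous_sum)
  moreover have "homogeneous ((1 + (int (e j) - 1)) + 0) (var_x * d_x (f j) * unit_vec 1 k)"
    "homogeneous ((1 + (int (e j) - 1)) + 0) (var_y * d_y (f j) * unit_vec 2 k)"
    "homogeneous ((1 + (int (e j) - 1)) + 0) (var_z * d_z (f j) * unit_vec 3 k)"
    by (intro homogeneous_mult homogeneous_var homogeneous_derivatives j u)+
  ultimately show ?thesis unfolding rho_def by (intro homogeneous_diff homogeneous_add) simp_all
qed

lemma homogeneous_rho_map:
  assumes "\<And>j. j \<in> {4..m} \<Longrightarrow> homogeneous (a - int (e j)) (w j)"
  shows "homogeneous a (rho_map m f w k)"
  unfolding rho_map_def
proof (rule homogeneous_sum)
  fix j assume "j \<in> {4..m}"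
  then have "homogeneous ((a - int (e j)) + int (e j)) (w j * rho m f j k)"
    by (intro homogeneous_mult assms homogeneous_rho)
  then show "homogeneous a (w j * rho m f j k)" by simp
qed

text \<open>The entries of \<open>\<rho>\<^sub>j\<close> are homogeneous of degree \<open>e\<^sub>j > 0\<close>.\<close>

lemma rho_map_minimal: "rho_map m f w k \<in> max_ideal"
proof (rule mem_max_ideal_if_no_constant_term)
  have "mcoeff (rho m f j k) 0 0 0 = 0" if "j \<in> {4..m}" for j
    using that degree_pos[of j] by (intro homogeneous_constant_term[OF homogeneous_rho]) auto
  then show "mcoeff (rho_map m f w k) 0 0 0 = 0" by (simp add: rho_map_def mcoeff_000_mult)
qed

lemma d_ge: "d \<ge> 4"
proof -
  have "int m \<le> d"
    unfolding d_def using sum_mono[of "{1..m}" "\<lambda>_. 1" "\<lambda>j. int (e j)"] degree_pos by force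
  then show ?thesis using m by simp
qed

lemma D0_carrier_fprod: "D0_carrier fprod = omega_map m f ` F2"
proof -
  have "D0_carrier fprod = {\<theta>. dot \<theta> (ext_d fprod) = 0}"
    by (auto simp: D0_carrier_def dot_def ext_d_def)
  then show ?thesis using exact_at_D0 by auto
qed

lemma kernel_rho_map: "{w \<in> F3. rho_map m f w = (\<lambda>_. 0)} = {\<lambda>_. 0}"
proof -
  have "rho_map m f (\<lambda>_. 0) = (\<lambda>_. 0)" by (simp add: rho_map_def)
  then show ?thesis using rho_map_inj by (auto simp: free_carrier_def)
qed

lemma graded_hom_rho_map:
  "graded_hom (graded_free (({4..m}, \<lambda>j. a - int (e j)))) (graded_free ({1..m-1}, \<lambda>_. a)) (rho_map m f)"
  unfolding graded_hom_def
proof (intro conjI allI)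
  fix n
  show "rho_map m f ` component (graded_free ({4..m}, \<lambda>j. a - int (e j))) n
      \<subseteq> component (graded_free ({1..m-1}, \<lambda>_. a)) n"
  proof
    fix u assume "u \<in> rho_map m f ` component (graded_free ({4..m}, \<lambda>j. a - int (e j))) n"
    then obtain w where u: "u = rho_map m f w"
      and w: "\<And>j. j \<in> {4..m} \<Longrightarrow> homogeneous (a - int (e j) + n) (w j)" by auto
    have "homogeneous (a + n) (rho_map m f w k)" for k
    proof (rule homogeneous_rho_map)
      fix j assume "j \<in> {4..m}"
      then show "homogeneous (a + n - int (e j)) (w j)" using w by (simp add: algebra_simps)
    qed
    then show "u \<in> component (graded_free ({1..m-1}, \<lambda>_. a)) n" using u rho_map_carrier by simp
  qed
qed (simp_all add: rho_map_linear rho_map_carrier del: One_nat_def)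

lemma resolution_D0:
  "minimal_graded_free_resolution (D0 fprod)
     [({1..m-1}, \<lambda>_. - d + 2), ({4..m}, \<lambda>j. - d + 2 - int (e j))] (omega_map m f) [rho_map m f]"
proof (rule minimal_resolution_of_length_1)
  show "graded_hom (graded_free ({1..m-1}, \<lambda>_. - d + 2)) (D0 fprod) (omega_map m f)"
    unfolding graded_hom_def
  proof (intro conjI allI)
    fix n
    show "omega_map m f ` component (graded_free ({1..m-1}, \<lambda>_. - d + 2)) n \<subseteq> component (D0 fprod) n"
    proof
      fix t assume "t \<in> omega_map m f ` component (graded_free ({1..m-1}, \<lambda>_. - d + 2)) n"
      then obtain v where t: "t = omega_map m f v" "v \<in> F2"
        and v: "\<And>i. i \<in> {1..m-1} \<Longrightarrow> homogeneous (- d + 2 + n) (v i)" by auto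
      have "homogeneous_triple ((- d + 2 + n) + (d - 2)) t"
        unfolding t(1) using v by (rule homogeneous_omega_map)
      then have "homogeneous_triple n t" by simp
      moreover have "t \<in> D0_carrier fprod" using t D0_carrier_fprod by blast
      ultimately show "t \<in> component (D0 fprod) n"
        by (auto simp: D0_def homogeneous_triple_def)
    qed
  qed (auto simp: D0_def D0_carrier_fprod omega_map_linear simp del: One_nat_def)
  show "omega_map m f ` F2 = carrier (D0 fprod)" by (simp add: D0_def D0_carrier_fprod)
  show "{v \<in> F2. omega_map m f v = \<zero>\<^bsub>D0 fprod\<^esub>} = rho_map m f ` F3"
    using exact_at_F2 rho_map_carrier by (auto simp: D0_def simp del: One_nat_def)
qed (use kernel_rho_map rho_map_minimal graded_hom_rho_map in auto)

lemma jacobian_ideal_fprod: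
  "jacobian_ideal fprod = {dot t (ext_d fprod) | t. True}"
proof -
  have "{a * d_x fprod + b * d_y fprod + c * d_z fprod | a b c. True} = {dot t (ext_d fprod) | t. True}"
    by (force simp: dot_def ext_d_def)
  then show ?thesis by (simp only: jacobian_ideal_def genideal_3)
qed

text \<open>The syzygies of the partial derivatives are the kernel of \<open>S\<^sup>3 \<rightarrow> S\<close>, so the resolution of \<open>D\<^sub>0\<close> can be
  continued by this map. The new maps have entries of degrees \<open>d - 1\<close> and \<open>d - 2\<close>, both positive.\<close>

lemma resolution_milnor_algebra:
  "has_minimal_resolution_of_shape (milnor_algebra fprod)
     [({0}, \<lambda>_. 0), ({1..3}, \<lambda>_. - d + 1), ({1..m-1}, \<lambda>_. - 2 * d + 3), ({4..m}, \<lambda>j. - 2 * d + 3 - int (e j))]"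
proof -
  define J where "J = jacobian_ideal fprod"
  have J: "J = {dot t (ext_d fprod) | t. True}" unfolding J_def by (rule jacobian_ideal_fprod)
  have "ideal J S"
    unfolding J_def jacobian_ideal_def
    by (rule ring.genideal_ideal[OF ring_from_type_algebra]) (simp add: ring_of_type_algebra_def)
  then interpret J: ideal J S .
  have S: "carrier S = UNIV" "\<And>p q. p \<oplus>\<^bsub>S\<^esub> q = p + (q :: mpoly)" "\<And>p q. p \<otimes>\<^bsub>S\<^esub> q = p * (q :: mpoly)"
    by (simp_all add: ring_of_type_algebra_def)
  define \<epsilon> where "\<epsilon> v = J +>\<^bsub>S\<^esub> v 0" for v :: "nat \<Rightarrow> mpoly"
  define \<delta> where "\<delta> v k = (if k = 0 then dot (v 1, v 2, v 3) (ext_d fprod) else 0)" for v :: "nat \<Rightarrow> mpoly" and k :: nat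
  define \<omega> where "\<omega> v = triple_vec (omega_map m f v)" for v
  have partial: "homogeneous_triple (d - 1) (ext_d fprod)"
    using homogeneous_derivatives[of d fprod] homogeneous_cofactor[of "{}"]
    by (simp add: homogeneous_triple_def ext_d_def)
  have M: "carrier (milnor_algebra fprod) = range (\<lambda>p. J +>\<^bsub>S\<^esub> p)" "\<zero>\<^bsub>milnor_algebra fprod\<^esub> = J"
    "component (milnor_algebra fprod) n = {J +>\<^bsub>S\<^esub> p | p. homogeneous n p}"
    "\<And>p q. (J +>\<^bsub>S\<^esub> p) \<oplus>\<^bsub>milnor_algebra fprod\<^esub> (J +>\<^bsub>S\<^esub> q) = J +>\<^bsub>S\<^esub> (p + q)"
    "\<And>p q. p \<odot>\<^bsub>milnor_algebra fprod\<^esub> (J +>\<^bsub>S\<^esub> q) = J +>\<^bsub>S\<^esub> (p * q)" for n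
    using ring_hom_add[OF J.rcos_ring_hom] ring_hom_mult[OF J.rcos_ring_hom]
    by (auto simp: milnor_algebra_def Let_def J_def[symmetric] FactRing_def S A_RCOSETS_def')
  have "minimal_graded_free_resolution (milnor_algebra fprod)
     [({0}, \<lambda>_. 0), ({1..3}, \<lambda>_. - d + 1), ({1..m-1}, \<lambda>_. - 2 * d + 3), ({4..m}, \<lambda>j. - 2 * d + 3 - int (e j))]
     \<epsilon> [\<delta>, \<omega>, rho_map m f]"
  proof (rule minimal_resolution_of_length_3)
    show "graded_hom (graded_free ({0}, \<lambda>_. 0)) (milnor_algebra fprod) \<epsilon>"
      unfolding graded_hom_def by (auto simp: \<epsilon>_def M)
    show "graded_hom (graded_free ({1..3}, \<lambda>_. - d + 1)) (graded_free ({0}, \<lambda>_. 0)) \<delta>"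
      unfolding graded_hom_def
    proof (intro conjI allI)
      fix n
      show "\<delta> ` component (graded_free ({1..3}, \<lambda>_. - d + 1)) n \<subseteq> component (graded_free ({0}, \<lambda>_. 0)) n"
      proof
        fix u assume "u \<in> \<delta> ` component (graded_free ({1..3}, \<lambda>_. - d + 1)) n"
        then obtain v where u: "u = \<delta> v"
          and v: "\<And>i. i \<in> {1..3} \<Longrightarrow> homogeneous (- d + 1 + n) (v i)" by auto
        have "homogeneous ((- d + 1 + n) + (d - 1)) (dot (v 1, v 2, v 3) (ext_d fprod))"
          using partial v unfolding dot_def prod.case ext_d_def homogeneous_triple_def
          by (intro homogeneous_add homogeneous_mult) auto
        then show "u \<in> component (graded_free ({0}, \<lambda>_. 0)) n"
          by (simp add: u \<delta>_def free_carrier_def)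
      qed
    qed (auto simp: \<delta>_def free_carrier_def dot_def fun_eq_iff algebra_simps split: prod.splits)
    show "graded_hom (graded_free ({1..m-1}, \<lambda>_. - 2 * d + 3)) (graded_free ({1..3}, \<lambda>_. - d + 1)) \<omega>"
      unfolding graded_hom_def
    proof (intro conjI allI)
      fix n
      show "\<omega> ` component (graded_free ({1..m-1}, \<lambda>_. - 2 * d + 3)) n
          \<subseteq> component (graded_free ({1..3}, \<lambda>_. - d + 1)) n"
      proof
        fix u assume "u \<in> \<omega> ` component (graded_free ({1..m-1}, \<lambda>_. - 2 * d + 3)) n"
        then obtain v where u: "u = \<omega> v"
          and v: "\<And>i. i \<in> {1..m-1} \<Longrightarrow> homogeneous (- 2 * d + 3 + n) (v i)" by auto
        have "homogeneous_triple ((- 2 * d + 3 + n) + (d - 2)) (omega_map m f v)"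
          using v by (rule homogeneous_omega_map)
        then have "homogeneous_triple (- d + 1 + n) (omega_map m f v)" by (simp add: algebra_simps)
        then show "u \<in> component (graded_free ({1..3}, \<lambda>_. - d + 1)) n"
          unfolding u \<omega>_def by (cases "omega_map m f v") (auto simp: homogeneous_triple_def free_carrier_def)
      qed
    next
      show "\<omega> \<in> carrier (graded_free ({1..m-1}, \<lambda>_. - 2 * d + 3)) \<rightarrow> carrier (graded_free ({1..3}, \<lambda>_. - d + 1))"
      proof
        fix v
        show "\<omega> v \<in> carrier (graded_free ({1..3}, \<lambda>_. - d + 1))"
          unfolding \<omega>_def by (cases "omega_map m f v") (auto simp: free_carrier_def)
      qed
    qed (simp_all add: \<omega>_def omega_map_linear triple_vec_linear)
    show "graded_hom (graded_free ({4..m}, \<lambda>j. - 2 * d + 3 - int (e j))) (graded_free ({1..m-1}, \<lambda>_. - 2 * d + 3))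
      (rho_map m f)" by (rule graded_hom_rho_map)
    show "\<epsilon> ` free_carrier {0} = carrier (milnor_algebra fprod)"
    proof (unfold M, intro equalityI subsetI)
      fix c assume "c \<in> range (\<lambda>p. J +>\<^bsub>S\<^esub> p)"
      then obtain p where "c = J +>\<^bsub>S\<^esub> p" by blast
      then have "c = \<epsilon> (\<lambda>k. if k = 0 then p else 0)" by (simp add: \<epsilon>_def)
      then show "c \<in> \<epsilon> ` free_carrier {0}" by (auto simp: free_carrier_def)
    qed (auto simp: \<epsilon>_def)
    have coset: "J +>\<^bsub>S\<^esub> p = J \<longleftrightarrow> p \<in> J" for p
      using J.rcos_const_imp_mem[of p] J.a_rcos_const[of p] by (auto simp: S)
    show "{v \<in> free_carrier {0}. \<epsilon> v = \<zero>\<^bsub>milnor_algebra fprod\<^esub>} = \<delta> ` free_carrier {1..3}"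
    proof (intro equalityI subsetI)
      fix v assume "v \<in> {v \<in> free_carrier {0}. \<epsilon> v = \<zero>\<^bsub>milnor_algebra fprod\<^esub>}"
      then have v: "v \<in> free_carrier {0}" and "v 0 \<in> J" by (simp_all add: \<epsilon>_def M(2) coset)
      then obtain t where t: "v 0 = dot t (ext_d fprod)" unfolding J by blast
      define u where "u = triple_vec t"
      have "u \<in> free_carrier {1..3}" "t = (u 1, u 2, u 3)"
        unfolding u_def by (cases t; simp add: free_carrier_def)+
      with t v have "v = \<delta> u" by (auto simp: \<delta>_def free_carrier_def fun_eq_iff)
      then show "v \<in> \<delta> ` free_carrier {1..3}" using \<open>u \<in> _\<close> by blast
    next
      fix v assume "v \<in> \<delta> ` free_carrier {1..3}"
      then obtain u where v: "v = \<delta> u" by blast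
      then have "v 0 \<in> J" unfolding J \<delta>_def by auto
      then show "v \<in> {v \<in> free_carrier {0}. \<epsilon> v = \<zero>\<^bsub>milnor_algebra fprod\<^esub>}"
        using v by (simp add: \<epsilon>_def M(2) coset \<delta>_def free_carrier_def)
    qed
    show "{v \<in> free_carrier {1..3}. \<delta> v = (\<lambda>_. 0)} = \<omega> ` F2"
    proof (intro equalityI subsetI)
      fix v assume "v \<in> {v \<in> free_carrier {1..3}. \<delta> v = (\<lambda>_. 0)}"
      then have v: "v \<in> free_carrier {1..3}" "\<delta> v 0 = 0" by auto
      then have "(v 1, v 2, v 3) \<in> omega_map m f ` F2"
        by (intro exact_at_D0[THEN iffD1]) (simp add: \<delta>_def)
      then obtain w where w: "w \<in> F2" "(v 1, v 2, v 3) = omega_map m f w" by blast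
      then have "\<omega> w = v" using triple_vec_surj[OF v(1)] by (simp only: \<omega>_def)
      then show "v \<in> \<omega> ` F2" using w(1) by blast
    next
      fix v assume "v \<in> \<omega> ` F2"
      then obtain w where w: "w \<in> F2" "v = \<omega> w" by blast
      obtain a b c where abc: "omega_map m f w = (a, b, c)" by (metis prod_cases3)
      then have "dot (a, b, c) (ext_d fprod) = 0" using exact_at_D0 w(1) by (metis image_eqI)
      then show "v \<in> {v \<in> free_carrier {1..3}. \<delta> v = (\<lambda>_. 0)}"
        by (auto simp: w(2) \<omega>_def abc free_carrier_def \<delta>_def fun_eq_iff)
    qed
    show "{v \<in> F2. \<omega> v = (\<lambda>_. 0)} = rho_map m f ` F3"
      unfolding \<omega>_def triple_vec_eq_0 using exact_at_F2 rho_map_carrier by auto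
    show "{w \<in> F3. rho_map m f w = (\<lambda>_. 0)} = {\<lambda>_. 0}" by (rule kernel_rho_map)
    show "\<delta> v k \<in> max_ideal" for v k
    proof (rule mem_max_ideal_if_no_constant_term)
      have "mcoeff (d_x fprod) 0 0 0 = 0" "mcoeff (d_y fprod) 0 0 0 = 0" "mcoeff (d_z fprod) 0 0 0 = 0"
        using partial d_ge homogeneous_constant_term[of "d - 1"]
        by (simp_all add: homogeneous_triple_def ext_d_def del: mcoeff_derivatives)
      then show "mcoeff (\<delta> v k) 0 0 0 = 0"
        by (simp add: \<delta>_def dot_def ext_d_def mcoeff_000_mult del: mcoeff_derivatives)
    qed
    show "\<omega> v k \<in> max_ideal" for v k
    proof (rule mem_max_ideal_if_no_constant_term)
      have "mcoeff (triple_vec (omega m f i) k) 0 0 0 = 0" if "i \<in> {1..m-1}" for i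
        using that homogeneous_omega[of i] d_ge homogeneous_constant_term[of "d - 2"]
        by (cases "omega m f i") (auto simp: homogeneous_triple_def)
      moreover have "\<omega> v k = (\<Sum>i\<in>{1..m-1}. v i * triple_vec (omega m f i) k)"
      proof -
        have "triple_vec (sum g A) k = (\<Sum>i\<in>A. triple_vec (g i) k)" for g :: "nat \<Rightarrow> triple" and A
          by (induction A rule: infinite_finite_induct) (simp_all add: triple_vec_linear zero_prod_def)
        then show ?thesis by (simp add: \<omega>_def omega_map_def triple_vec_linear)
      qed
      ultimately show "mcoeff (\<omega> v k) 0 0 0 = 0" by (simp add: mcoeff_000_mult)
    qed
    show "rho_map m f v k \<in> max_ideal" for v k by (rule rho_map_minimal)
  qed simp_all
  then show ?thesis unfolding has_minimal_resolution_of_shape_def by blast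
qed

end

theorem theorem1p6:
  fixes m :: nat and e :: "nat \<Rightarrow> nat" and f :: "nat \<Rightarrow> mpoly" and F :: mpoly and d :: int
  assumes "m \<ge> 4"
    and "\<forall>j\<in>{1..m}. homogeneous (int (e j)) (f j)"
    and "\<forall>j\<in>{1..m}. Factorial_Ring.irreducible (f j)"
    and "\<forall>i\<in>{1..m}. \<forall>j\<in>{1..m}. i \<noteq> j \<longrightarrow> \<not> f i dvd f j"
    and "\<forall>j\<in>{1..m}. smooth_curve (f j)"
    and "normal_crossing {1..m} f"
    and "f 1 = var_x" and "f 2 = var_y" and "f 3 = var_z"
    and "F = (\<Prod>j\<in>{1..m}. f j)"
    and "d = (\<Sum>j\<in>{1..m}. int (e j))"
  shows "has_minimal_resolution_of_shape (D0 F)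
           [({1..m-1}, \<lambda>_. - d + 2), ({4..m}, \<lambda>j. - d + 2 - int (e j))]
       \<and> has_minimal_resolution_of_shape (milnor_algebra F)
           [({0}, \<lambda>_. 0), ({1..3}, \<lambda>_. - d + 1), ({1..m-1}, \<lambda>_. - 2 * d + 3),
            ({4..m}, \<lambda>j. - 2 * d + 3 - int (e j))]
       \<and> minimal_graded_free_resolution (D0 F)
           [({1..m-1}, \<lambda>_. - d + 2), ({4..m}, \<lambda>j. - d + 2 - int (e j))]
           (omega_map m f) [rho_map m f]
       \<and> (\<forall>j\<in>{4..m}.
            f j \<bullet> (if j = m then - (\<Sum>i\<in>{1..m-1}. omega m f i) else omega m f j)
            - ((var_x * d_x (f j)) \<bullet> omega m f 1 + (var_y * d_y (f j)) \<bullet> omega m f 2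
               + (var_z * d_z (f j)) \<bullet> omega m f 3) = 0)"
proof -
  interpret A: nc_arrangement m f e
  proof
    show "f j \<noteq> 0" if "j \<in> {1..m}" for j using assms(3) that by (auto simp: irreducible_def)
  qed (use assms in auto)
  have F: "F = A.fprod" by (simp add: assms(10) A.cofactor_def)
  have d: "d = A.d" by (simp add: assms(11) A.d_def)
  show ?thesis
    using A.resolution_D0 A.resolution_milnor_algebra A.rho_relation
    unfolding F d has_minimal_resolution_of_shape_def by blast
qed

end
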